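(* Consider a 2-cell downlink network with BSs 1, 2, each with $N_t\ge2$ antennas, and one single-antenna user per cell. Channels $\mathbf{h}_{i,j}\in\mathbb{C}^{N_t}$ ($i,j\in\{1,2\}$) are mutually independent with i.i.d. $\mathcal{CN}(0,1)$ entries, and perfect channel knowledge is available at the BSs. Each BS $j$ selects $s_j\in\{BF,IC\}$ with precoder $\mathbf{f}_{j,s_j}$ as in the context. Given fixed (deterministic) received powers $P^r_{1,1},P^r_{1,2}>0$, define $$\mathrm{SINR}_1(s_1,s_2)=\frac{P^r_{1,1}|\mathbf{h}_{1,1}^*\mathbf{f}_{1,s_1}|^2}{1+P^r_{1,2}|\mathbf{h}_{1,2}^*\mathbf{f}_{2,s_2}|^2},\qquad R_1(s_1,s_2)=\mathbb{E}[\log_2(1+\mathrm{SINR}_1(s_1,s_2))].$$ Then $R_1(BF,BF)=R_I^{(2)}(P^r_{1,1},P^r_{1,2},N_t)$, $R_1(BF,IC)=R_{BF}(P^r_{1,1},N_t)$, $R_1(IC,IC)=R_{BF}(P^r_{1,1},N_t-1)$, and $R_1(IC,BF)=R_I^{(2)}(P^r_{1,1},P^r_{1,2},N_t-1)$.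
   Context: Precoders: $\mathbf{f}_{j,BF}=\mathbf{h}_{j,j}/\|\mathbf{h}_{j,j}\|$; for $IC$, BS $j$ cancels interference to the user of the other cell $k\neq j$: $\mathbf{f}_{j,IC}=\mathbf{w}/\|\mathbf{w}\|$ with $\mathbf{w}=\big(\mathbf{I}-\mathbf{h}_{k,j}\mathbf{h}_{k,j}^*/\|\mathbf{h}_{k,j}\|^2\big)\mathbf{h}_{j,j}$. Functions: for $\gamma>0$ and integer $M\ge1$, $R_{BF}(\gamma,M)=\log_2(e)\,e^{1/\gamma}\sum_{k=0}^{M-1}\frac{\Gamma(-k,1/\gamma)}{\gamma^k}$, where $\Gamma(s,x)=\int_x^\infty t^{s-1}e^{-t}dt$ is the upper incomplete gamma function; $R_I^{(2)}(\gamma_1,\gamma_2,M)=\log_2(e)\sum_{i=0}^{M-1}\sum_{l=0}^{i}\frac{\gamma_1^{\,l+1-i}}{\gamma_2(i-l)!}I_1\!\left(\frac1{\gamma_1},\frac{\gamma_1}{\gamma_2},i,l+1\right)$, with $I_1(a,b,m,n)=\int_0^\infty\frac{x^me^{-ax}}{(x+b)^n(x+1)}dx$. *)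

theory Defs
  imports "HOL-Probability.Probability"
begin

definition upper_inc_gamma :: "real \<Rightarrow> real \<Rightarrow> real" where
  "upper_inc_gamma s x = (\<integral>t\<in>{x<..}. t powr (s - 1) * exp (- t) \<partial>lborel)"

definition R_BF :: "real \<Rightarrow> nat \<Rightarrow> real" where
  "R_BF \<gamma> M = log 2 (exp 1) * exp (1 / \<gamma>) *
     (\<Sum>k<M. upper_inc_gamma (- real k) (1 / \<gamma>) / \<gamma> ^ k)"

definition I1 :: "real \<Rightarrow> real \<Rightarrow> nat \<Rightarrow> nat \<Rightarrow> real" where
  "I1 a b m n = (\<integral>x\<in>{0<..}. x ^ m * exp (- a * x) / ((x + b) ^ n * (x + 1)) \<partial>lborel)"

definition R_I2 :: "real \<Rightarrow> real \<Rightarrow> nat \<Rightarrow> real" where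
  "R_I2 \<gamma>1 \<gamma>2 M = log 2 (exp 1) *
     (\<Sum>i<M. \<Sum>l\<le>i. \<gamma>1 powi (int l + 1 - int i) / (\<gamma>2 * fact (i - l))
                      * I1 (1 / \<gamma>1) (\<gamma>1 / \<gamma>2) i (l + 1))"

(* ---------- vectors in C^Nt, represented as nat => complex on indices {..<Nt} ---------- *)

definition cinner :: "nat \<Rightarrow> (nat \<Rightarrow> complex) \<Rightarrow> (nat \<Rightarrow> complex) \<Rightarrow> complex" where
  "cinner Nt x y = (\<Sum>k<Nt. cnj (x k) * y k)"

definition vnorm :: "nat \<Rightarrow> (nat \<Rightarrow> complex) \<Rightarrow> real" where
  "vnorm Nt x = sqrt (\<Sum>k<Nt. (cmod (x k))\<^sup>2)"

definition bf_prec :: "nat \<Rightarrow> (nat \<Rightarrow> complex) \<Rightarrow> (nat \<Rightarrow> complex)" where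
  "bf_prec Nt h = (\<lambda>k. h k / complex_of_real (vnorm Nt h))"

text \<open>f_IC = w / ||w||, w = (I - g g^* / ||g||^2) h, where h = own direct channel,
  g = channel from this BS to the other cell's user.\<close>
definition ic_prec :: "nat \<Rightarrow> (nat \<Rightarrow> complex) \<Rightarrow> (nat \<Rightarrow> complex) \<Rightarrow> (nat \<Rightarrow> complex)" where
  "ic_prec Nt g h =
     (let w = (\<lambda>k. h k - g k * cinner Nt g h / complex_of_real ((vnorm Nt g)\<^sup>2))
      in (\<lambda>k. w k / complex_of_real (vnorm Nt w)))"

datatype strategy = BF | IC

definition prec :: "nat \<Rightarrow> strategy \<Rightarrow> (nat \<Rightarrow> complex) \<Rightarrow> (nat \<Rightarrow> complex) \<Rightarrow> (nat \<Rightarrow> complex)" where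
  "prec Nt s g h = (case s of BF \<Rightarrow> bf_prec Nt h | IC \<Rightarrow> ic_prec Nt g h)"

definition CN_std :: "complex measure" where
  "CN_std = density lborel (\<lambda>z. ennreal (exp (- (cmod z)\<^sup>2) / pi))"

text \<open>Outcome omega: (i,j,k) maps to the k-th entry of h_{i,j} (channel from BS j to user i),
  for i,j in {1,2}, k < Nt; all entries i.i.d. CN(0,1).\<close>
definition chan_space :: "nat \<Rightarrow> (nat \<times> nat \<times> nat \<Rightarrow> complex) measure" where
  "chan_space Nt = PiM ({1,2} \<times> {1,2} \<times> {..<Nt}) (\<lambda>_. CN_std)"

definition chan :: "(nat \<times> nat \<times> nat \<Rightarrow> complex) \<Rightarrow> nat \<Rightarrow> nat \<Rightarrow> (nat \<Rightarrow> complex)" where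
  "chan \<omega> i j = (\<lambda>k. \<omega> (i, j, k))"

text \<open>f_{1,s}: BS 1 (direct channel h_{1,1}, cancels towards user 2 via h_{2,1});
      f_{2,s}: BS 2 (direct channel h_{2,2}, cancels towards user 1 via h_{1,2}).\<close>
definition SINR1 :: "nat \<Rightarrow> real \<Rightarrow> real \<Rightarrow> strategy \<Rightarrow> strategy \<Rightarrow> (nat \<times> nat \<times> nat \<Rightarrow> complex) \<Rightarrow> real" where
  "SINR1 Nt P11 P12 s1 s2 \<omega> =
     (let f1 = prec Nt s1 (chan \<omega> 2 1) (chan \<omega> 1 1);
          f2 = prec Nt s2 (chan \<omega> 1 2) (chan \<omega> 2 2)
      in P11 * (cmod (cinner Nt (chan \<omega> 1 1) f1))\<^sup>2
         / (1 + P12 * (cmod (cinner Nt (chan \<omega> 1 2) f2))\<^sup>2))"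

definition rate1 :: "nat \<Rightarrow> real \<Rightarrow> real \<Rightarrow> strategy \<Rightarrow> strategy \<Rightarrow> real" where
  "rate1 Nt P11 P12 s1 s2 = (\<integral>\<omega>. log 2 (1 + SINR1 Nt P11 P12 s1 s2 \<omega>) \<partial>chan_space Nt)"

end

theory Submission
  imports Defs
begin

text \<open>
  Zero forcing removes the interference exactly, so only two laws are needed. For independent
  standard complex Gaussian vectors \<open>g\<close> and \<open>h\<close>, the coordinate of \<open>h\<close> along \<open>g\<close> is a standard
  complex Gaussian, whose energy is exponential, and the energy of the rejection of \<open>h\<close> from \<open>g\<close> is
  independent of it and distributed like the energy of a Gaussian vector with one entry less, hence
  Erlang. This joint law follows by induction on the dimension from the invariance of a pair of
  standard complex Gaussians under \<open>SU(2)\<close>; elements of \<open>SL(2)\<close> are products of shears, which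
  preserve Lebesgue measure by translation invariance.

  The rates come from \<open>E ln (1 + S) = \<integral> P (S > t) / (1 + t) dt\<close>: the tail of the SINR is a finite
  combination of terms \<open>t ^ m * exp (- a * t) / (t + b) ^ n\<close>. For \<open>n = 0\<close> the resulting integral is
  an incomplete gamma function because \<open>1 / (1 + t) = \<integral> exp (- r * (1 + t)) dr\<close>.
\<close>

subsection \<open>Image measures and independence\<close>

lemma (in sigma_finite_measure) emeasure_distr_pair:
  assumes f: "case_prod f \<in> measurable (N \<Otimes>\<^sub>M M) L" and X: "X \<in> sets L"
  shows "emeasure (distr (N \<Otimes>\<^sub>M M) L (case_prod f)) X = (\<integral>\<^sup>+x. emeasure (distr M L (f x)) X \<partial>N)"
proof -
  let ?preimage = "case_prod f -` X \<inter> space (N \<Otimes>\<^sub>M M)"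
  have "emeasure (distr (N \<Otimes>\<^sub>M M) L (case_prod f)) X = (\<integral>\<^sup>+x. emeasure M (Pair x -` ?preimage) \<partial>N)"
    using measurable_sets[OF f X] by (simp add: emeasure_distr[OF f X] emeasure_pair_measure_alt)
  also have "\<dots> = (\<integral>\<^sup>+x. emeasure (distr M L (f x)) X \<partial>N)"
  proof (rule nn_integral_cong)
    fix x assume x: "x \<in> space N"
    have "f x \<in> measurable M L"
      using measurable_Pair2[OF f x] by simp
    then show "emeasure M (Pair x -` ?preimage) = emeasure (distr M L (f x)) X"
      using X x
      by (auto simp: emeasure_distr space_pair_measure intro!: arg_cong[where f="emeasure M"])
  qed
  finally show ?thesis .
qed

lemma (in sigma_finite_measure) distr_pair_eq_if_AE_section:
  assumes N: "prob_space N" and f: "case_prod f \<in> measurable (N \<Otimes>\<^sub>M M) L"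
    and sets: "sets L = sets D" and section_law: "AE x in N. distr M L (f x) = D"
  shows "distr (N \<Otimes>\<^sub>M M) L (case_prod f) = D"
proof (rule measure_eqI)
  interpret N: prob_space N by fact
  fix X assume "X \<in> sets (distr (N \<Otimes>\<^sub>M M) L (case_prod f))"
  then have "emeasure (distr (N \<Otimes>\<^sub>M M) L (case_prod f)) X = (\<integral>\<^sup>+x. emeasure (distr M L (f x)) X \<partial>N)"
    by (intro emeasure_distr_pair[OF f]) simp
  also have "\<dots> = (\<integral>\<^sup>+x. emeasure D X \<partial>N)"
    using section_law by (intro nn_integral_cong_AE) auto
  finally show "emeasure (distr (N \<Otimes>\<^sub>M M) L (case_prod f)) X = emeasure D X"
    by (simp add: N.emeasure_space_1)
qed (simp add: sets)

lemma (in sigma_finite_measure) distr_pair_skew_eq: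
  assumes T: "case_prod T \<in> measurable (N \<Otimes>\<^sub>M M) M"
    and invariant: "\<And>x. x \<in> space N \<Longrightarrow> distr M M (T x) = M"
  shows "distr (N \<Otimes>\<^sub>M M) (N \<Otimes>\<^sub>M M) (\<lambda>(x, y). (x, T x y)) = N \<Otimes>\<^sub>M M"
    (is "distr ?P ?P ?skew = ?P")
proof (rule measure_eqI)
  have skew: "?skew \<in> measurable ?P ?P"
    using T by (simp add: case_prod_beta')
  fix X assume "X \<in> sets (distr ?P ?P ?skew)"
  then have X: "X \<in> sets ?P" by simp
  have "emeasure (distr ?P ?P ?skew) X = (\<integral>\<^sup>+x. emeasure (distr M ?P (\<lambda>y. (x, T x y))) X \<partial>N)"
    by (rule emeasure_distr_pair[OF skew X])
  also have "\<dots> = (\<integral>\<^sup>+x. emeasure (distr M ?P (Pair x)) X \<partial>N)"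
  proof (rule nn_integral_cong)
    fix x assume x: "x \<in> space N"
    have "T x \<in> measurable M M"
      using measurable_Pair2[OF T x] by simp
    then have "distr M ?P (\<lambda>y. (x, T x y)) = distr (distr M M (T x)) ?P (Pair x)"
      using x by (subst distr_distr) (simp_all add: comp_def)
    then show "emeasure (distr M ?P (\<lambda>y. (x, T x y))) X = emeasure (distr M ?P (Pair x)) X"
      by (simp add: invariant[OF x])
  qed
  also have "\<dots> = emeasure ?P X"
    using emeasure_distr_pair[of Pair N ?P X] X by (simp add: id_def)
  finally show "emeasure (distr ?P ?P ?skew) X = emeasure ?P X" .
qed simp

lemma distr_pair_assoc:
  assumes "sigma_finite_measure M" "sigma_finite_measure N" "sigma_finite_measure L"
  shows "distr (M \<Otimes>\<^sub>M (N \<Otimes>\<^sub>M L)) ((M \<Otimes>\<^sub>M N) \<Otimes>\<^sub>M L) (\<lambda>(x, y, z). ((x, y), z)) = (M \<Otimes>\<^sub>M N) \<Otimes>\<^sub>M L"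
    (is "?D = ?P")
proof (rule measure_eqI)
  interpret N: sigma_finite_measure N by fact
  interpret L: sigma_finite_measure L by fact
  interpret NL: pair_sigma_finite N L ..
  fix X assume "X \<in> sets ?D"
  then have [measurable]: "X \<in> sets ?P" by simp
  have "emeasure ?D X
      = (\<integral>\<^sup>+p. indicator X (case p of (x, y, z) \<Rightarrow> ((x, y), z)) \<partial>(M \<Otimes>\<^sub>M (N \<Otimes>\<^sub>M L)))"
    by (subst nn_integral_indicator[symmetric], simp, subst nn_integral_distr) auto
  also have "\<dots> = (\<integral>\<^sup>+x. \<integral>\<^sup>+q. indicator X ((x, fst q), snd q) \<partial>(N \<Otimes>\<^sub>M L) \<partial>M)"
    by (simp add: NL.P.nn_integral_fst[symmetric] case_prod_beta')
  also have "\<dots> = (\<integral>\<^sup>+x. \<integral>\<^sup>+y. \<integral>\<^sup>+z. indicator X ((x, y), z) \<partial>L \<partial>N \<partial>M)"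
    by (intro nn_integral_cong, subst L.nn_integral_fst[symmetric]) simp_all
  also have "\<dots> = (\<integral>\<^sup>+p. \<integral>\<^sup>+z. indicator X (p, z) \<partial>L \<partial>(M \<Otimes>\<^sub>M N))"
    by (subst N.nn_integral_fst[symmetric]) auto
  also have "\<dots> = emeasure ?P X"
    by (rule L.emeasure_pair_measure[symmetric]) measurable
  finally show "emeasure ?D X = emeasure ?P X" .
qed simp

lemma distr_pair_map_fst:
  assumes "f \<in> measurable M K" "prob_space N"
  shows "distr (M \<Otimes>\<^sub>M N) (K \<Otimes>\<^sub>M N) (\<lambda>(x, y). (f x, y)) = distr M K f \<Otimes>\<^sub>M N"
  using pair_measure_distr[of f M K "\<lambda>y. y" N N] assms by (simp add: prob_space_imp_sigma_finite)

lemma distr_pair_map_snd: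
  assumes "g \<in> measurable N L" "prob_space N"
  shows "distr (M \<Otimes>\<^sub>M N) (M \<Otimes>\<^sub>M L) (\<lambda>(x, y). (x, g y)) = M \<Otimes>\<^sub>M distr N L g"
  using pair_measure_distr[of "\<lambda>x. x" M M g N L] assms
  by (simp add: prob_space_imp_sigma_finite prob_space.prob_space_distr)

lemma distributed_distr_iff:
  "f \<in> measurable M N \<Longrightarrow> X \<in> measurable N L \<Longrightarrow>
    distributed (distr M N f) L X d \<longleftrightarrow> distributed M L (\<lambda>x. X (f x)) d"
  by (simp add: distributed_def distr_distr comp_def)

lemma indep_vars_PiM_components:
  assumes M: "\<And>i. i \<in> I \<Longrightarrow> prob_space (M i)"
  shows "prob_space.indep_vars (PiM I M) M (\<lambda>i \<omega>. \<omega> i) I"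
proof -
  interpret prob_space "PiM I M" by (rule prob_space_PiM) (rule M)
  show ?thesis
  proof (cases "I = {}")
    case True
    then show ?thesis
      unfolding indep_vars_def indep_sets_def by simp
  next
    case False
    have "distr (PiM I M) (PiM I M) (\<lambda>\<omega>. restrict \<omega> I) = PiM I M"
      by (subst distr_cong[OF refl refl, of _ _ "\<lambda>\<omega>. \<omega>"]) (auto simp: space_PiM)
    also have "\<dots> = PiM I (\<lambda>i. distr (PiM I M) (M i) (\<lambda>\<omega>. \<omega> i))"
      using M by (intro PiM_cong refl) (rule distr_PiM_component[symmetric])
    finally show ?thesis
      using False by (subst indep_vars_iff_distr_eq_PiM') auto
  qed
qed

lemma indep_var_PiM_restrict:
  assumes M: "\<And>i. i \<in> I \<Longrightarrow> prob_space (M i)" and JK: "J \<inter> K = {}" "J \<subseteq> I" "K \<subseteq> I"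
    and f: "f \<in> measurable (PiM J M) S" and g: "g \<in> measurable (PiM K M) T"
  shows "prob_space.indep_var (PiM I M) S (\<lambda>\<omega>. f (restrict \<omega> J)) T (\<lambda>\<omega>. g (restrict \<omega> K))"
proof -
  interpret prob_space "PiM I M" by (rule prob_space_PiM) (rule M)
  have "indep_vars M (\<lambda>i \<omega>. \<omega> i) I"
    by (rule indep_vars_PiM_components) (rule M)
  from indep_var_compose[OF indep_var_restrict[OF this JK] f g] show ?thesis
    by (simp add: comp_def)
qed

subsection \<open>Shears and determinant-one maps\<close>

lemma distr_comp_eq_self:
  assumes "distr M M f = M" "distr M M g = M" "f \<in> measurable M M" "g \<in> measurable M M"
  shows "distr M M (f \<circ> g) = M"
  using assms distr_distr[of f M M g M] by simp

lemma distr_lborel_pair_shear_snd: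
  fixes f :: "'a::euclidean_space \<Rightarrow> 'b::euclidean_space"
  assumes [measurable]: "f \<in> borel_measurable borel"
  shows "distr (lborel \<Otimes>\<^sub>M lborel) (lborel \<Otimes>\<^sub>M lborel) (\<lambda>(x, y). (x, y + f x)) = lborel \<Otimes>\<^sub>M lborel"
proof (rule lborel.distr_pair_skew_eq)
  show "distr lborel lborel (\<lambda>y. y + f x) = lborel" for x
    using lborel_distr_plus[of "f x"] by (simp add: add.commute cong: distr_cong)
qed measurable

lemma distr_lborel_pair_shear_fst:
  fixes f :: "'b::euclidean_space \<Rightarrow> 'a::euclidean_space"
  assumes [measurable]: "f \<in> borel_measurable borel"
  shows "distr (lborel \<Otimes>\<^sub>M lborel) (lborel \<Otimes>\<^sub>M lborel) (\<lambda>(x, y). (x + f y, y)) = lborel \<Otimes>\<^sub>M lborel"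
proof -
  let ?swap = "\<lambda>(x, y). (y, x)"
  have "lborel \<Otimes>\<^sub>M lborel = distr (lborel \<Otimes>\<^sub>M lborel) (lborel \<Otimes>\<^sub>M lborel) ?swap"
    by (rule lborel_pair.distr_pair_swap)
  also have "\<dots> = distr (distr (lborel \<Otimes>\<^sub>M lborel) (lborel \<Otimes>\<^sub>M lborel) (\<lambda>(x, y). (x, y + f x)))
      (lborel \<Otimes>\<^sub>M lborel) ?swap"
    by (simp add: distr_lborel_pair_shear_snd)
  also have "\<dots> = distr (distr (lborel \<Otimes>\<^sub>M lborel) (lborel \<Otimes>\<^sub>M lborel) ?swap)
      (lborel \<Otimes>\<^sub>M lborel) (\<lambda>(x, y). (x + f y, y))"
    by (simp add: distr_distr comp_def case_prod_beta')
  also have "distr (lborel \<Otimes>\<^sub>M lborel) (lborel \<Otimes>\<^sub>M lborel) ?swap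
      = (lborel \<Otimes>\<^sub>M lborel :: ('a \<times> 'b) measure)"
    by (rule lborel_pair.distr_pair_swap[symmetric])
  finally show ?thesis ..
qed

lemma distr_lborel_pair_det_1_if_neq_0:
  fixes a b c d :: "'a::{euclidean_space, real_normed_field}"
  assumes det: "a * d - b * c = 1" and c: "c \<noteq> 0"
  shows "distr (lborel \<Otimes>\<^sub>M lborel) (lborel \<Otimes>\<^sub>M lborel) (\<lambda>(x, y). (a * x + b * y, c * x + d * y))
    = lborel \<Otimes>\<^sub>M lborel"
proof -
  define upper where "upper p = (\<lambda>(x, y). (x + p * y, y))" for p :: 'a
  define lower where "lower = (\<lambda>(x, y). (x, y + c * x))"
  define p q where "p = (a - 1) / c" and "q = (d - 1) / c"
  have [measurable]: "lower \<in> measurable (lborel \<Otimes>\<^sub>M lborel) (lborel \<Otimes>\<^sub>M lborel)"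
      "upper r \<in> measurable (lborel \<Otimes>\<^sub>M lborel) (lborel \<Otimes>\<^sub>M lborel)" for r
    unfolding upper_def lower_def by measurable
  have "distr (lborel \<Otimes>\<^sub>M lborel) (lborel \<Otimes>\<^sub>M lborel) (upper r) = lborel \<Otimes>\<^sub>M lborel" for r
    unfolding upper_def by (rule distr_lborel_pair_shear_fst) measurable
  moreover have "distr (lborel \<Otimes>\<^sub>M lborel) (lborel \<Otimes>\<^sub>M lborel) lower = lborel \<Otimes>\<^sub>M lborel"
    unfolding lower_def by (rule distr_lborel_pair_shear_snd) measurable
  ultimately have "distr (lborel \<Otimes>\<^sub>M lborel) (lborel \<Otimes>\<^sub>M lborel) (upper p \<circ> (lower \<circ> upper q))
      = lborel \<Otimes>\<^sub>M lborel"
    by (intro distr_comp_eq_self measurable_comp) measurable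
  moreover have "a = 1 + p * c" "d = 1 + c * q" "b = p + a * q"
    using det c by (simp_all add: p_def q_def field_simps)
  then have "(\<lambda>(x, y). (a * x + b * y, c * x + d * y)) = upper p \<circ> (lower \<circ> upper q)"
    by (simp add: fun_eq_iff upper_def lower_def algebra_simps)
  ultimately show ?thesis
    by simp
qed

lemma distr_lborel_pair_det_1:
  fixes a b c d :: "'a::{euclidean_space, real_normed_field}"
  assumes det: "a * d - b * c = 1"
  shows "distr (lborel \<Otimes>\<^sub>M lborel) (lborel \<Otimes>\<^sub>M lborel) (\<lambda>(x, y). (a * x + b * y, c * x + d * y))
    = lborel \<Otimes>\<^sub>M lborel"
proof (cases "c = 0")
  case True
  \<comment> \<open>adding the first row to the second makes the lower left entry nonzero\<close>
  let ?T = "\<lambda>(x, y). (a * x + b * y, a * x + (b + d) * y)"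
  have "a * (b + d) - b * a = 1" "a \<noteq> 0"
    using det True by (auto simp: algebra_simps)
  then have "distr (lborel \<Otimes>\<^sub>M lborel) (lborel \<Otimes>\<^sub>M lborel) ?T = lborel \<Otimes>\<^sub>M lborel"
    by (rule distr_lborel_pair_det_1_if_neq_0)
  moreover have "distr (lborel \<Otimes>\<^sub>M lborel) (lborel \<Otimes>\<^sub>M lborel) (\<lambda>(x, y). (x, y + (- 1) * x))
      = (lborel \<Otimes>\<^sub>M lborel :: ('a \<times> 'a) measure)"
    by (rule distr_lborel_pair_shear_snd) measurable
  ultimately have "distr (lborel \<Otimes>\<^sub>M lborel) (lborel \<Otimes>\<^sub>M lborel)
      ((\<lambda>(x, y). (x, y + (- 1) * x)) \<circ> ?T) = lborel \<Otimes>\<^sub>M lborel"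
    by (intro distr_comp_eq_self) measurable
  moreover have "(\<lambda>(x, y). (a * x + b * y, c * x + d * y)) = (\<lambda>(x, y). (x, y + (- 1) * x)) \<circ> ?T"
    using True by (auto simp: fun_eq_iff algebra_simps)
  ultimately show ?thesis
    by simp
qed (rule distr_lborel_pair_det_1_if_neq_0[OF det])

subsection \<open>The standard complex Gaussian\<close>

lemma sets_CN_std [measurable_cong, simp]: "sets CN_std = sets borel"
  by (simp add: CN_std_def)

lemma space_CN_std [simp]: "space CN_std = UNIV"
  by (simp add: CN_std_def)

lemma distributed_lborel_cmod_square:
  "distributed lborel lborel (\<lambda>z::complex. (cmod z)\<^sup>2) (\<lambda>t. ennreal (pi * indicator {0..} t))"
proof (rule distributedI_borel_atMost[where g="\<lambda>a. pi * max 0 a"])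
  fix a :: real
  have "ennreal (pi * indicator {0..} t * indicator {..a} t) = ennreal pi * indicator {0..a} t"
    for t
    by (simp split: split_indicator)
  then have "(\<integral>\<^sup>+t. ennreal (pi * indicator {0..} t * indicator {..a} t) \<partial>lborel)
      = ennreal pi * emeasure lborel {0..a}"
    by (simp only:) (rule nn_integral_cmult_indicator, simp)
  also have "\<dots> = ennreal (pi * max 0 a)"
    by (cases "a \<ge> 0") (simp_all add: ennreal_mult')
  finally show "(\<integral>\<^sup>+t. ennreal (pi * indicator {0..} t * indicator {..a} t) \<partial>lborel)
      = ennreal (pi * max 0 a)" .
  have "(cmod z)\<^sup>2 \<le> a \<longleftrightarrow> z \<in> cball 0 (sqrt a)" for z
    using real_sqrt_le_iff[of "(cmod z)\<^sup>2" a] by simp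
  then have "{z \<in> space lborel. (cmod z)\<^sup>2 \<le> a} = cball 0 (sqrt a)"
    by (simp add: set_eq_iff)
  then show "emeasure lborel {z \<in> space lborel. (cmod z)\<^sup>2 \<le> a} = ennreal (pi * max 0 a)"
    by (cases "a \<ge> 0") (simp_all add: emeasure_cball unit_ball_vol_2)
qed auto

lemma distributed_CN_std_cmod_square:
  "distributed CN_std lborel (\<lambda>z. (cmod z)\<^sup>2) (exponential_density 1)"
proof -
  have "distr CN_std lborel (\<lambda>z. (cmod z)\<^sup>2)
      = density (distr lborel lborel (\<lambda>z::complex. (cmod z)\<^sup>2)) (\<lambda>t. ennreal (exp (- t) / pi))"
    unfolding CN_std_def by (rule density_distr[symmetric]) measurable
  also have "\<dots> = density lborel (\<lambda>t. ennreal (pi * indicator {0..} t) * ennreal (exp (- t) / pi))"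
    unfolding distributed_distr_eq_density[OF distributed_lborel_cmod_square]
    by (rule density_density_eq) measurable
  also have "\<dots> = density lborel (exponential_density 1)"
    by (intro density_cong)
      (auto simp: exponential_density_def ennreal_mult[symmetric] split: split_indicator)
  finally show ?thesis
    by (simp add: distributed_def)
qed

lemma prob_space_CN_std: "prob_space CN_std"
proof (rule prob_space_distrD)
  show "(\<lambda>z. (cmod z)\<^sup>2) \<in> measurable CN_std lborel"
    by measurable
  show "prob_space (distr CN_std lborel (\<lambda>z. (cmod z)\<^sup>2))"
    unfolding distributed_distr_eq_density[OF distributed_CN_std_cmod_square]
    by (simp add: prob_space_exponential_density)
qed

lemma CN_std_pair_eq_density:
  "CN_std \<Otimes>\<^sub>M CN_std
    = density (lborel \<Otimes>\<^sub>M lborel) (\<lambda>(z, w). ennreal (exp (- ((cmod z)\<^sup>2 + (cmod w)\<^sup>2)) / pi\<^sup>2))"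
proof -
  have "sigma_finite_measure CN_std"
    by (rule prob_space_imp_sigma_finite[OF prob_space_CN_std])
  then have "CN_std \<Otimes>\<^sub>M CN_std = density (lborel \<Otimes>\<^sub>M lborel)
      (\<lambda>(z, w). ennreal (exp (- (cmod z)\<^sup>2) / pi) * ennreal (exp (- (cmod w)\<^sup>2) / pi))"
    unfolding CN_std_def by (intro pair_measure_density sigma_finite_lborel) measurable
  also have "(\<lambda>(z, w). ennreal (exp (- (cmod z)\<^sup>2) / pi) * ennreal (exp (- (cmod w)\<^sup>2) / pi))
      = (\<lambda>(z, w). ennreal (exp (- ((cmod z)\<^sup>2 + (cmod w)\<^sup>2)) / pi\<^sup>2))"
    by (simp add: fun_eq_iff ennreal_mult[symmetric] exp_add[symmetric] power2_eq_square)
  finally show ?thesis .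
qed

lemma cmod_square_unitary:
  assumes "(cmod a)\<^sup>2 + (cmod b)\<^sup>2 = 1"
  shows "(cmod (a * z + b * w))\<^sup>2 + (cmod (cnj a * w - cnj b * z))\<^sup>2 = (cmod z)\<^sup>2 + (cmod w)\<^sup>2"
proof -
  have "(cmod (a * z + b * w))\<^sup>2 + (cmod (cnj a * w - cnj b * z))\<^sup>2
      = ((cmod a)\<^sup>2 + (cmod b)\<^sup>2) * ((cmod z)\<^sup>2 + (cmod w)\<^sup>2)"
    by (simp add: cmod_power2) (simp add: power2_eq_square algebra_simps)
  then show ?thesis
    using assms by simp
qed

lemma distr_CN_std_pair_unitary:
  assumes ab: "(cmod a)\<^sup>2 + (cmod b)\<^sup>2 = 1"
  shows "distr (CN_std \<Otimes>\<^sub>M CN_std) (CN_std \<Otimes>\<^sub>M CN_std)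
      (\<lambda>(z, w). (a * z + b * w, cnj a * w - cnj b * z)) = CN_std \<Otimes>\<^sub>M CN_std"
    (is "distr _ _ ?U = _")
proof -
  let ?d = "\<lambda>(z, w). ennreal (exp (- ((cmod z)\<^sup>2 + (cmod w)\<^sup>2)) / pi\<^sup>2)"
  have "a * cnj a - b * (- cnj b) = 1"
    using arg_cong[OF ab, of complex_of_real] by (simp add: complex_norm_square del: of_real_power)
  then have lborel: "distr (lborel \<Otimes>\<^sub>M lborel) (lborel \<Otimes>\<^sub>M lborel) ?U = lborel \<Otimes>\<^sub>M lborel"
    using distr_lborel_pair_det_1[of a "cnj a" b "- cnj b"] by (simp add: add.commute)
  have density_invariant: "?d (?U p) = ?d p" for p
    by (cases p) (simp only: prod.case cmod_square_unitary[OF ab])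
  have "distr (CN_std \<Otimes>\<^sub>M CN_std) (CN_std \<Otimes>\<^sub>M CN_std) ?U
      = distr (density (lborel \<Otimes>\<^sub>M lborel) (\<lambda>p. ?d (?U p))) (lborel \<Otimes>\<^sub>M lborel) ?U"
    unfolding CN_std_pair_eq_density density_invariant by (rule distr_cong) auto
  also have "\<dots> = density (distr (lborel \<Otimes>\<^sub>M lborel) (lborel \<Otimes>\<^sub>M lborel) ?U) ?d"
    by (rule density_distr[symmetric]) measurable
  also have "\<dots> = CN_std \<Otimes>\<^sub>M CN_std"
    by (simp only: lborel CN_std_pair_eq_density)
  finally show ?thesis .
qed

lemma distr_CN_std_rotate:
  assumes "cmod a = 1"
  shows "distr CN_std CN_std ((*) a) = CN_std"
proof -
  interpret prob_space CN_std by (rule prob_space_CN_std)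
  let ?U = "\<lambda>(z, w). (a * z, cnj a * w)"
  have "distr CN_std CN_std ((*) a) = distr (distr (CN_std \<Otimes>\<^sub>M CN_std) CN_std fst) CN_std ((*) a)"
    by (simp add: distr_pair_fst)
  also have "\<dots> = distr (distr (CN_std \<Otimes>\<^sub>M CN_std) (CN_std \<Otimes>\<^sub>M CN_std) ?U) CN_std fst"
    by (simp add: distr_distr comp_def case_prod_beta')
  also have "\<dots> = CN_std"
    using distr_CN_std_pair_unitary[of a 0] assms by (simp add: distr_pair_fst)
  finally show ?thesis .
qed

subsection \<open>Complex Gaussian vectors\<close>

abbreviation CN_vec :: "nat \<Rightarrow> (nat \<Rightarrow> complex) measure" where
  "CN_vec n \<equiv> PiM {..<n} (\<lambda>_. CN_std)"

lemma prob_space_CN_vec: "prob_space (CN_vec n)"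
  by (rule prob_space_PiM) (rule prob_space_CN_std)

lemma vnorm_square: "(vnorm n h)\<^sup>2 = (\<Sum>k<n. (cmod (h k))\<^sup>2)"
  unfolding vnorm_def by (intro real_sqrt_pow2 sum_nonneg) auto

lemma vnorm_nonneg [simp]: "vnorm n h \<ge> 0"
  unfolding vnorm_def by (intro real_sqrt_ge_zero sum_nonneg) auto

lemma vnorm_Suc_square: "(vnorm (Suc n) h)\<^sup>2 = (vnorm n h)\<^sup>2 + (cmod (h n))\<^sup>2"
  by (simp add: vnorm_square)

lemma cinner_self: "cinner n h h = of_real ((vnorm n h)\<^sup>2)"
  unfolding cinner_def vnorm_square of_real_sum
  by (intro sum.cong) (auto simp: complex_norm_square mult.commute simp flip: of_real_power)

lemma cinner_eq_0_if_vnorm_eq_0: "vnorm n g = 0 \<Longrightarrow> cinner n g h = 0"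
  unfolding vnorm_def cinner_def by (simp add: sum_nonneg_eq_0_iff)

lemma measurable_cinner [measurable (raw)]:
  assumes f: "f \<in> measurable M (CN_vec n)" and g: "g \<in> measurable M (CN_vec n)"
  shows "(\<lambda>x. cinner n (f x) (g x)) \<in> borel_measurable M"
  unfolding cinner_def
proof (rule borel_measurable_sum)
  fix k assume "k \<in> {..<n}"
  then have [measurable]: "(\<lambda>x. f x k) \<in> borel_measurable M" "(\<lambda>x. g x k) \<in> borel_measurable M"
    using measurable_compose[OF f measurable_component_singleton[of k]]
      measurable_compose[OF g measurable_component_singleton[of k]]
    by (simp_all cong: measurable_cong_sets)
  have [measurable]: "cnj \<in> borel_measurable borel"
    by (intro borel_measurable_continuous_onI continuous_intros)
  show "(\<lambda>x. cnj (f x k) * g x k) \<in> borel_measurable M"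
    by measurable
qed

lemma measurable_vnorm [measurable (raw)]:
  assumes "f \<in> measurable M (CN_vec n)"
  shows "(\<lambda>x. vnorm n (f x)) \<in> borel_measurable M"
proof -
  have "vnorm n h = sqrt (Re (cinner n h h))" for h
    by (simp add: cinner_self)
  then show ?thesis
    using assms by simp
qed

lemma distributed_CN_vec_vnorm_square:
  "distributed (CN_vec (Suc n)) lborel (\<lambda>h. (vnorm (Suc n) h)\<^sup>2) (erlang_density n 1)"
proof -
  let ?V = "CN_vec (Suc n)"
  interpret prob_space ?V by (rule prob_space_CN_vec)
  have "distributed ?V lborel (\<lambda>h. (cmod (h k))\<^sup>2) (exponential_density 1)" if k: "k < Suc n" for k
  proof -
    have [measurable]: "(\<lambda>h. h k) \<in> measurable ?V CN_std"
        "(\<lambda>h. (cmod (h k))\<^sup>2) \<in> borel_measurable ?V"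
      using k by simp_all
    have "distr ?V lborel (\<lambda>h. (cmod (h k))\<^sup>2)
        = distr (distr ?V CN_std (\<lambda>h. h k)) lborel (\<lambda>z. (cmod z)\<^sup>2)"
      by (simp add: distr_distr comp_def)
    also have "distr ?V CN_std (\<lambda>h. h k) = CN_std"
      using k distr_PiM_component[of "{..<Suc n}" "\<lambda>_. CN_std" k] prob_space_CN_std by simp
    finally show ?thesis
      using distributed_CN_std_cmod_square by (simp add: distributed_def)
  qed
  moreover have "indep_vars (\<lambda>_. CN_std) (\<lambda>k h. h k) {..<Suc n}"
    by (rule indep_vars_PiM_components) (rule prob_space_CN_std)
  then have "indep_vars (\<lambda>_. borel) (\<lambda>k h. (cmod (h k))\<^sup>2) {..<Suc n}"
    by (rule indep_vars_compose2) measurable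
  ultimately have "distributed ?V lborel (\<lambda>h. \<Sum>k<Suc n. (cmod (h k))\<^sup>2)
      (erlang_density (card {..<Suc n} - 1) 1)"
    by (intro exponential_distributed_sum) auto
  then show ?thesis
    by (simp add: vnorm_square)
qed

lemma AE_CN_vec_vnorm_neq_0: "AE h in CN_vec (Suc n). vnorm (Suc n) h \<noteq> 0"
proof -
  interpret prob_space "CN_vec (Suc n)" by (rule prob_space_CN_vec)
  have "AE x in lborel. x \<noteq> (0::real)"
    by (rule AE_lborel_singleton)
  then have "AE h in CN_vec (Suc n). (vnorm (Suc n) h)\<^sup>2 \<noteq> 0"
    by (subst distributed_AE2[OF distributed_CN_vec_vnorm_square]) auto
  then show ?thesis
    by simp
qed

subsection \<open>Projections of Gaussian vectors\<close>

abbreviation CN_energy :: "nat \<Rightarrow> real measure" where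
  "CN_energy n \<equiv> distr (CN_vec n) borel (\<lambda>h. (vnorm n h)\<^sup>2)"

lemma prob_space_CN_energy: "prob_space (CN_energy n)"
  by (intro prob_space.prob_space_distr prob_space_CN_vec) measurable

text \<open>
  If \<open>g = 0\<close>, then \<open>coord_along n g h = 0\<close> because \<open>x / 0 = 0\<close>. By the same convention
  \<^const>\<open>ic_prec\<close> then ignores \<open>g\<close>, so the gain formulas for it hold without assuming \<open>g \<noteq> 0\<close>.
\<close>

definition coord_along :: "nat \<Rightarrow> (nat \<Rightarrow> complex) \<Rightarrow> (nat \<Rightarrow> complex) \<Rightarrow> complex" where
  "coord_along n g h = cinner n g h / of_real (vnorm n g)"

definition rejection_energy :: "nat \<Rightarrow> (nat \<Rightarrow> complex) \<Rightarrow> (nat \<Rightarrow> complex) \<Rightarrow> real" where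
  "rejection_energy n g h = (vnorm n h)\<^sup>2 - (cmod (coord_along n g h))\<^sup>2"

lemma measurable_coord_along [measurable (raw)]:
  "f \<in> measurable M (CN_vec n) \<Longrightarrow> g \<in> measurable M (CN_vec n) \<Longrightarrow>
    (\<lambda>x. coord_along n (f x) (g x)) \<in> borel_measurable M"
  unfolding coord_along_def by simp

lemma measurable_rejection_energy [measurable (raw)]:
  "f \<in> measurable M (CN_vec n) \<Longrightarrow> g \<in> measurable M (CN_vec n) \<Longrightarrow>
    (\<lambda>x. rejection_energy n (f x) (g x)) \<in> borel_measurable M"
  unfolding rejection_energy_def by simp

lemma measurable_coord_along_snd [measurable]: "coord_along n g \<in> borel_measurable (CN_vec n)"
  unfolding coord_along_def[abs_def] cinner_def by measurable

lemma measurable_rejection_energy_snd [measurable]: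
  "rejection_energy n g \<in> borel_measurable (CN_vec n)"
  unfolding rejection_energy_def[abs_def] by measurable

lemma measurable_fun_upd_CN_vec [measurable]:
  "(\<lambda>(y, h). h(n := y)) \<in> measurable (CN_std \<Otimes>\<^sub>M CN_vec n) (CN_vec (Suc n))"
  unfolding lessThan_Suc case_prod_beta' by measurable

lemma distr_fun_upd_CN_vec:
  "distr (CN_std \<Otimes>\<^sub>M CN_vec n) (CN_vec (Suc n)) (\<lambda>(y, h). h(n := y)) = CN_vec (Suc n)"
  unfolding lessThan_Suc by (rule distr_pair_PiM_eq_PiM) (rule prob_space_CN_std)+

lemma vnorm_fun_upd_eq [simp]: "vnorm n (h(n := y)) = vnorm n h"
  by (simp add: vnorm_def)

lemma CN_energy_Suc:
  "CN_energy (Suc n) = distr (CN_std \<Otimes>\<^sub>M CN_energy n) borel (\<lambda>(y, r). r + (cmod y)\<^sup>2)"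
proof -
  have "CN_energy (Suc n) = distr (CN_std \<Otimes>\<^sub>M CN_vec n) borel (\<lambda>(y, h). (vnorm n h)\<^sup>2 + (cmod y)\<^sup>2)"
    by (subst distr_fun_upd_CN_vec[symmetric])
      (simp add: distr_distr comp_def case_prod_beta', simp add: vnorm_Suc_square)
  also have "\<dots> = distr (CN_std \<Otimes>\<^sub>M CN_energy n) borel (\<lambda>(y, r). r + (cmod y)\<^sup>2)"
    by (subst distr_pair_map_snd[symmetric])
      (auto simp: prob_space_CN_vec distr_distr comp_def case_prod_beta')
  finally show ?thesis .
qed

lemma distr_CN_std_rotate_energy:
  assumes ab: "(cmod a)\<^sup>2 + (cmod b)\<^sup>2 = 1" and E: "prob_space E" "sets E = sets borel"
  shows "distr (CN_std \<Otimes>\<^sub>M (CN_std \<Otimes>\<^sub>M E)) (CN_std \<Otimes>\<^sub>M borel)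
      (\<lambda>(z, w, r). (a * z + b * w, r + (cmod (cnj a * w - cnj b * z))\<^sup>2))
    = CN_std \<Otimes>\<^sub>M distr (CN_std \<Otimes>\<^sub>M E) borel (\<lambda>(w, r). r + (cmod w)\<^sup>2)"
proof -
  note [measurable_cong] = E(2)
  let ?U = "\<lambda>(z, w). (a * z + b * w, cnj a * w - cnj b * z)"
  let ?absorb = "\<lambda>((z, w), r). (z, r + (cmod w)\<^sup>2)"
  have prob: "prob_space (CN_std \<Otimes>\<^sub>M E)"
    by (rule prob_space_pair[OF prob_space_CN_std E(1)])
  have assoc: "(CN_std \<Otimes>\<^sub>M CN_std) \<Otimes>\<^sub>M E
      = distr (CN_std \<Otimes>\<^sub>M (CN_std \<Otimes>\<^sub>M E)) ((CN_std \<Otimes>\<^sub>M CN_std) \<Otimes>\<^sub>M E) (\<lambda>(z, w, r). ((z, w), r))"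
    using prob_space_CN_std E(1) by (intro distr_pair_assoc[symmetric] prob_space_imp_sigma_finite)
  have "distr (CN_std \<Otimes>\<^sub>M (CN_std \<Otimes>\<^sub>M E)) (CN_std \<Otimes>\<^sub>M borel)
      (\<lambda>(z, w, r). (a * z + b * w, r + (cmod (cnj a * w - cnj b * z))\<^sup>2))
    = distr (distr ((CN_std \<Otimes>\<^sub>M CN_std) \<Otimes>\<^sub>M E) ((CN_std \<Otimes>\<^sub>M CN_std) \<Otimes>\<^sub>M E) (\<lambda>(p, r). (?U p, r)))
        (CN_std \<Otimes>\<^sub>M borel) ?absorb"
    by (subst assoc) (simp add: distr_distr comp_def case_prod_beta')
  also have "distr ((CN_std \<Otimes>\<^sub>M CN_std) \<Otimes>\<^sub>M E) ((CN_std \<Otimes>\<^sub>M CN_std) \<Otimes>\<^sub>M E) (\<lambda>(p, r). (?U p, r))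
      = (CN_std \<Otimes>\<^sub>M CN_std) \<Otimes>\<^sub>M E"
    by (subst distr_pair_map_fst) (auto simp: E distr_CN_std_pair_unitary[OF ab])
  also have "distr ((CN_std \<Otimes>\<^sub>M CN_std) \<Otimes>\<^sub>M E) (CN_std \<Otimes>\<^sub>M borel) ?absorb
      = distr (CN_std \<Otimes>\<^sub>M (CN_std \<Otimes>\<^sub>M E)) (CN_std \<Otimes>\<^sub>M borel)
          (\<lambda>(z, p). (z, case p of (w, r) \<Rightarrow> r + (cmod w)\<^sup>2))"
    by (subst assoc) (simp add: distr_distr comp_def case_prod_beta')
  also have "\<dots> = CN_std \<Otimes>\<^sub>M distr (CN_std \<Otimes>\<^sub>M E) borel (\<lambda>(w, r). r + (cmod w)\<^sup>2)"
    by (rule distr_pair_map_snd[OF _ prob]) measurable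
  finally show ?thesis .
qed

definition last_weight :: "nat \<Rightarrow> (nat \<Rightarrow> complex) \<Rightarrow> complex" where
  "last_weight n g = cnj (g n) / of_real (vnorm (Suc n) g)"

definition init_weight :: "nat \<Rightarrow> (nat \<Rightarrow> complex) \<Rightarrow> complex" where
  "init_weight n g = of_real (vnorm n g / vnorm (Suc n) g)"

lemma cmod_square_last_weight_init_weight:
  assumes "vnorm (Suc n) g \<noteq> 0"
  shows "(cmod (last_weight n g))\<^sup>2 + (cmod (init_weight n g))\<^sup>2 = 1"
  using assms vnorm_Suc_square[of n g]
  by (auto simp: last_weight_def init_weight_def norm_divide power_divide
      add_divide_distrib[symmetric])

lemma coord_along_Suc_upd:
  "coord_along (Suc n) g (h(n := y)) = last_weight n g * y + init_weight n g * coord_along n g h"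
proof -
  have "cinner (Suc n) g (h(n := y)) = cinner n g h + cnj (g n) * y"
    by (simp add: cinner_def)
  then show ?thesis
    by (cases "vnorm n g = 0")
      (simp_all add: coord_along_def last_weight_def init_weight_def add_divide_distrib
        cinner_eq_0_if_vnorm_eq_0)
qed

lemma rejection_energy_Suc_upd:
  assumes "vnorm (Suc n) g \<noteq> 0"
  shows "rejection_energy (Suc n) g (h(n := y)) = rejection_energy n g h
    + (cmod (cnj (last_weight n g) * coord_along n g h - cnj (init_weight n g) * y))\<^sup>2"
  using cmod_square_unitary[OF cmod_square_last_weight_init_weight[OF assms],
      of y "coord_along n g h"]
  unfolding rejection_energy_def coord_along_Suc_upd vnorm_Suc_square by simp

lemma distr_CN_vec_projection_Suc:
  assumes "vnorm (Suc n) g \<noteq> 0"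
  shows "distr (CN_vec (Suc n)) (CN_std \<Otimes>\<^sub>M borel)
      (\<lambda>h. (coord_along (Suc n) g h, rejection_energy (Suc n) g h))
    = distr (CN_std \<Otimes>\<^sub>M distr (CN_vec n) (CN_std \<Otimes>\<^sub>M borel)
          (\<lambda>h. (coord_along n g h, rejection_energy n g h)))
        (CN_std \<Otimes>\<^sub>M borel) (\<lambda>(z, w, r). (last_weight n g * z + init_weight n g * w,
          r + (cmod (cnj (last_weight n g) * w - cnj (init_weight n g) * z))\<^sup>2))"
  by (subst distr_pair_map_snd[symmetric], measurable, rule prob_space_CN_vec,
      subst distr_fun_upd_CN_vec[symmetric])
    (simp add: distr_distr comp_def case_prod_beta' coord_along_Suc_upd
      rejection_energy_Suc_upd[OF assms])

lemma distr_CN_vec_projection_last_axis: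
  assumes "vnorm (Suc n) g \<noteq> 0" and g: "vnorm n g = 0"
  shows "distr (CN_vec (Suc n)) (CN_std \<Otimes>\<^sub>M borel)
      (\<lambda>h. (coord_along (Suc n) g h, rejection_energy (Suc n) g h)) = CN_std \<Otimes>\<^sub>M CN_energy n"
proof -
  have init: "init_weight n g = 0" and coord: "coord_along n g h = 0"
      and rejection: "rejection_energy n g h = (vnorm n h)\<^sup>2" for h
    by (simp_all add: init_weight_def rejection_energy_def coord_along_def g)
  have "(cmod (last_weight n g))\<^sup>2 = 1"
    using cmod_square_last_weight_init_weight[OF assms(1)] by (simp add: init)
  then have unimodular: "cmod (last_weight n g) = 1"
    unfolding power2_eq_1_iff using norm_ge_zero[of "last_weight n g"] by linarith
  have "distr (CN_vec (Suc n)) (CN_std \<Otimes>\<^sub>M borel)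
      (\<lambda>h. (coord_along (Suc n) g h, rejection_energy (Suc n) g h))
    = distr (CN_std \<Otimes>\<^sub>M CN_vec n) (CN_std \<Otimes>\<^sub>M borel)
        (\<lambda>(z, h). (last_weight n g * z, (vnorm n h)\<^sup>2))"
    by (subst distr_fun_upd_CN_vec[symmetric])
      (simp add: distr_distr comp_def case_prod_beta' coord_along_Suc_upd
        rejection_energy_Suc_upd[OF assms(1)] init coord rejection)
  also have "\<dots> = distr CN_std CN_std ((*) (last_weight n g)) \<Otimes>\<^sub>M CN_energy n"
    by (rule pair_measure_distr[symmetric])
      (auto intro: prob_space_imp_sigma_finite prob_space_CN_energy)
  finally show ?thesis
    by (simp only: distr_CN_std_rotate[OF unimodular])
qed

lemma distr_CN_vec_projection:
  assumes "vnorm (Suc n) g \<noteq> 0"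
  shows "distr (CN_vec (Suc n)) (CN_std \<Otimes>\<^sub>M borel)
      (\<lambda>h. (coord_along (Suc n) g h, rejection_energy (Suc n) g h)) = CN_std \<Otimes>\<^sub>M CN_energy n"
  using assms
proof (induction n)
  case 0
  then show ?case
    by (intro distr_CN_vec_projection_last_axis) (simp_all add: vnorm_def)
next
  case (Suc n)
  show ?case
  proof (cases "vnorm (Suc n) g = 0")
    case True
    with Suc.prems show ?thesis
      by (rule distr_CN_vec_projection_last_axis)
  next
    case False
    show ?thesis
      unfolding distr_CN_vec_projection_Suc[OF Suc.prems] Suc.IH[OF False] CN_energy_Suc
      by (intro distr_CN_std_rotate_energy cmod_square_last_weight_init_weight[OF Suc.prems]
          prob_space_CN_energy) simp
  qed
qed

lemma distr_CN_vec_pair_projection: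
  "distr (CN_vec (Suc n) \<Otimes>\<^sub>M CN_vec (Suc n)) (CN_std \<Otimes>\<^sub>M borel)
      (\<lambda>(g, h). (coord_along (Suc n) g h, rejection_energy (Suc n) g h)) = CN_std \<Otimes>\<^sub>M CN_energy n"
proof (rule sigma_finite_measure.distr_pair_eq_if_AE_section)
  show "sigma_finite_measure (CN_vec (Suc n))"
    by (rule prob_space_imp_sigma_finite) (rule prob_space_CN_vec)
  show "AE g in CN_vec (Suc n). distr (CN_vec (Suc n)) (CN_std \<Otimes>\<^sub>M borel)
      (\<lambda>h. (coord_along (Suc n) g h, rejection_energy (Suc n) g h)) = CN_std \<Otimes>\<^sub>M CN_energy n"
    using AE_CN_vec_vnorm_neq_0 by eventually_elim (rule distr_CN_vec_projection)
qed (use prob_space_CN_vec in auto)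

lemma distributed_coord_along_square:
  "distributed (CN_vec (Suc n) \<Otimes>\<^sub>M CN_vec (Suc n)) lborel
    (\<lambda>(g, h). (cmod (coord_along (Suc n) g h))\<^sup>2) (exponential_density 1)"
proof -
  interpret E: prob_space "CN_energy n" by (rule prob_space_CN_energy)
  have "distr (CN_vec (Suc n) \<Otimes>\<^sub>M CN_vec (Suc n)) lborel
      (\<lambda>(g, h). (cmod (coord_along (Suc n) g h))\<^sup>2)
    = distr (distr (CN_std \<Otimes>\<^sub>M CN_energy n) CN_std fst) lborel (\<lambda>z. (cmod z)\<^sup>2)"
    unfolding distr_CN_vec_pair_projection[symmetric]
    by (simp add: distr_distr comp_def case_prod_beta')
  then show ?thesis
    using distributed_CN_std_cmod_square
    by (simp add: E.distr_pair_fst distributed_def case_prod_beta')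
qed

lemma distributed_rejection_energy:
  "distributed (CN_vec (Suc (Suc n)) \<Otimes>\<^sub>M CN_vec (Suc (Suc n))) lborel
    (\<lambda>(g, h). rejection_energy (Suc (Suc n)) g h) (erlang_density n 1)"
proof -
  let ?m = "Suc n"
  interpret E: prob_space "CN_energy ?m" by (rule prob_space_CN_energy)
  have "distr (CN_vec (Suc ?m) \<Otimes>\<^sub>M CN_vec (Suc ?m)) lborel (\<lambda>(g, h). rejection_energy (Suc ?m) g h)
      = distr (CN_std \<Otimes>\<^sub>M CN_energy ?m) lborel (\<lambda>(z, r). r)"
    unfolding distr_CN_vec_pair_projection[symmetric]
    by (simp add: distr_distr comp_def case_prod_beta')
  also have "\<dots> = CN_energy ?m"
    by (rule E.distr_pair_eq_if_AE_section[OF prob_space_CN_std]) (simp_all add: distr_id2)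
  also have "\<dots> = distr (CN_vec ?m) lborel (\<lambda>h. (vnorm ?m h)\<^sup>2)"
    by (rule distr_cong) simp_all
  also have "\<dots> = density lborel (erlang_density n 1)"
    by (rule distributed_distr_eq_density[OF distributed_CN_vec_vnorm_square])
  finally show ?thesis
    by (simp add: distributed_def case_prod_beta')
qed

subsection \<open>Expected logarithms through tail probabilities\<close>

lemma set_integral_eq_enn2real:
  fixes f :: "'a \<Rightarrow> real"
  assumes [measurable]: "f \<in> borel_measurable M" "A \<in> sets M" and "\<And>x. x \<in> A \<Longrightarrow> 0 \<le> f x"
  shows "(\<integral>x\<in>A. f x \<partial>M) = enn2real (\<integral>\<^sup>+x\<in>A. ennreal (f x) \<partial>M)"
proof -
  have "(\<integral>x\<in>A. f x \<partial>M) = enn2real (\<integral>\<^sup>+x. ennreal (indicator A x *\<^sub>R f x) \<partial>M)"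
    unfolding set_lebesgue_integral_def
    using assms(3) by (intro integral_eq_nn_integral) (auto split: split_indicator)
  also have "(\<integral>\<^sup>+x. ennreal (indicator A x *\<^sub>R f x) \<partial>M) = (\<integral>\<^sup>+x\<in>A. ennreal (f x) \<partial>M)"
    by (intro nn_integral_cong) (simp split: split_indicator)
  finally show ?thesis .
qed

lemma set_integral_sum:
  fixes f :: "'i \<Rightarrow> 'a \<Rightarrow> 'b::{banach, second_countable_topology}"
  assumes "\<And>i. i \<in> I \<Longrightarrow> set_integrable M A (f i)"
  shows "(LINT x:A|M. (\<Sum>i\<in>I. f i x)) = (\<Sum>i\<in>I. LINT x:A|M. f i x)"
  using assms unfolding set_integrable_def set_lebesgue_integral_def
  by (simp add: scaleR_sum_right Bochner_Integration.integral_sum)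

lemma ln_one_plus_eq_nn_integral:
  fixes s :: real
  assumes "s \<ge> 0"
  shows "ennreal (ln (1 + s)) = (\<integral>\<^sup>+t\<in>{0<..<s}. ennreal (1 / (1 + t)) \<partial>lborel)"
proof -
  have "(\<integral>\<^sup>+t\<in>{0<..<s}. ennreal (1 / (1 + t)) \<partial>lborel)
      = (\<integral>\<^sup>+t\<in>{0..s}. ennreal (1 / (1 + t)) \<partial>lborel)"
  proof (rule nn_integral_cong_AE)
    show "AE t in lborel. ennreal (1 / (1 + t)) * indicator {0<..<s} t
        = ennreal (1 / (1 + t)) * indicator {0..s} t"
      using AE_lborel_singleton[of 0] AE_lborel_singleton[of s]
      by eventually_elim (auto split: split_indicator)
  qed
  also have "\<dots> = ennreal (ln (1 + s) - ln (1 + 0))"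
    using assms by (intro nn_integral_FTC_Icc) (auto intro!: derivative_eq_intros)
  finally show ?thesis
    by simp
qed

lemma (in prob_space) expectation_ln_one_plus_eq_tail_integral:
  assumes [measurable]: "random_variable borel S" and nonneg: "AE \<omega> in M. 0 \<le> S \<omega>"
  shows "expectation (\<lambda>\<omega>. ln (1 + S \<omega>)) = (\<integral>t\<in>{0<..}. \<P>(\<omega> in M. t < S \<omega>) / (1 + t) \<partial>lborel)"
proof -
  interpret pair_sigma_finite M lborel ..
  let ?f = "\<lambda>\<omega> t. ennreal (1 / (1 + t)) * indicator {0<..} t * indicator {\<omega> \<in> space M. t < S \<omega>} \<omega>"
  have "expectation (\<lambda>\<omega>. ln (1 + S \<omega>)) = enn2real (\<integral>\<^sup>+\<omega>. ennreal (ln (1 + S \<omega>)) \<partial>M)"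
    using nonneg by (intro integral_eq_nn_integral) auto
  also have "(\<integral>\<^sup>+\<omega>. ennreal (ln (1 + S \<omega>)) \<partial>M) = (\<integral>\<^sup>+\<omega>. \<integral>\<^sup>+t. ?f \<omega> t \<partial>lborel \<partial>M)"
  proof (rule nn_integral_cong_AE)
    show "AE \<omega> in M. ennreal (ln (1 + S \<omega>)) = (\<integral>\<^sup>+t. ?f \<omega> t \<partial>lborel)"
      using nonneg AE_space
      by eventually_elim
        (auto simp: ln_one_plus_eq_nn_integral intro!: nn_integral_cong split: split_indicator)
  qed
  also have "\<dots> = (\<integral>\<^sup>+t. \<integral>\<^sup>+\<omega>. ?f \<omega> t \<partial>M \<partial>lborel)"
    by (rule Fubini'[symmetric]) measurable
  also have "\<dots> = (\<integral>\<^sup>+t\<in>{0<..}. ennreal (\<P>(\<omega> in M. t < S \<omega>) / (1 + t)) \<partial>lborel)"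
    by (intro nn_integral_cong, subst nn_integral_cmult)
      (auto simp: emeasure_eq_measure ennreal_mult[symmetric] split: split_indicator)
  also have "enn2real \<dots> = (\<integral>t\<in>{0<..}. \<P>(\<omega> in M. t < S \<omega>) / (1 + t) \<partial>lborel)"
    by (rule set_integral_eq_enn2real[symmetric]) (auto simp: measure_def)
  finally show ?thesis .
qed

subsection \<open>The integrals \<open>I1\<close> and the incomplete gamma function\<close>

lemma nn_integral_power_exp:
  fixes b :: real
  assumes b: "b > 0"
  shows "(\<integral>\<^sup>+t\<in>{0<..}. ennreal (t ^ i * exp (- b * t)) \<partial>lborel) = ennreal (fact i / b ^ Suc i)"
proof -
  have "(\<integral>\<^sup>+t\<in>{0<..}. ennreal (t ^ i * exp (- b * t)) \<partial>lborel)
      = (\<integral>\<^sup>+t. ennreal (1 / b) * ennreal (erlang_density 0 b t * t ^ i) \<partial>lborel)"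
  proof (rule nn_integral_cong_AE)
    show "AE t in lborel. ennreal (t ^ i * exp (- b * t)) * indicator {0<..} t
        = ennreal (1 / b) * ennreal (erlang_density 0 b t * t ^ i)"
      using AE_lborel_singleton[of 0]
      by eventually_elim
        (use b in \<open>auto simp: erlang_density_def ennreal_mult[symmetric] mult.commute
          split: split_indicator\<close>)
  qed
  also have "\<dots> = ennreal (1 / b) * ennreal (fact i / b ^ i)"
    using nn_integral_erlang_ith_moment[OF b, of 0 i] by (simp add: nn_integral_cmult)
  also have "\<dots> = ennreal (fact i / b ^ Suc i)"
    using b by (simp add: ennreal_mult[symmetric])
  finally show ?thesis .
qed

lemma set_integrable_power_exp:
  fixes b :: real
  assumes "b > 0"
  shows "set_integrable lborel {0<..} (\<lambda>t. t ^ i * exp (- b * t))"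
  unfolding set_integrable_def
proof (rule integrableI_nonneg)
  have "(\<integral>\<^sup>+t. ennreal (indicator {0<..} t *\<^sub>R (t ^ i * exp (- b * t))) \<partial>lborel)
      = (\<integral>\<^sup>+t\<in>{0<..}. ennreal (t ^ i * exp (- b * t)) \<partial>lborel)"
    by (intro nn_integral_cong) (simp split: split_indicator)
  then show "(\<integral>\<^sup>+t. ennreal (indicator {0<..} t *\<^sub>R (t ^ i * exp (- b * t))) \<partial>lborel) < \<infinity>"
    using nn_integral_power_exp[OF assms] by simp
qed (auto split: split_indicator)

lemma set_integrable_I1:
  fixes a b :: real
  assumes a: "a > 0" and b: "b > 0"
  shows "set_integrable lborel {0<..} (\<lambda>x. x ^ m * exp (- a * x) / ((x + b) ^ n * (x + 1)))"
proof (rule set_integrable_bound)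
  show "set_integrable lborel {0<..} (\<lambda>x. 1 / b ^ n * (x ^ m * exp (- a * x)))"
    by (intro set_integrable_mult_right set_integrable_power_exp a)
  have "x ^ m * exp (- a * x) / ((x + b) ^ n * (x + 1)) \<le> 1 / b ^ n * (x ^ m * exp (- a * x))"
    if "x > 0" for x
  proof -
    have "b ^ n * 1 \<le> (x + b) ^ n * (x + 1)"
      using that b by (intro mult_mono power_mono) auto
    then have "x ^ m * exp (- a * x) / ((x + b) ^ n * (x + 1)) \<le> x ^ m * exp (- a * x) / b ^ n"
      using that b by (intro divide_left_mono) auto
    then show ?thesis
      by simp
  qed
  then show "AE x in lborel. x \<in> {0<..} \<longrightarrow> norm (x ^ m * exp (- a * x) / ((x + b) ^ n * (x + 1)))
      \<le> norm (1 / b ^ n * (x ^ m * exp (- a * x)))"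
    using b by (auto simp: abs_mult)
qed (simp add: set_borel_measurable_def)

lemma nn_integral_power_exp_div_one_plus:
  fixes a :: real
  assumes a: "a > 0"
  shows "(\<integral>\<^sup>+t\<in>{0<..}. ennreal (t ^ i * exp (- a * t) / (1 + t)) \<partial>lborel)
    = (\<integral>\<^sup>+r\<in>{0<..}. ennreal (fact i * exp (- r) / (a + r) ^ Suc i) \<partial>lborel)"
proof -
  let ?f = "\<lambda>t r. ennreal (t ^ i * exp (- a * t)) * indicator {0<..} t
    * (ennreal (exp (- (1 + t) * r)) * indicator {0<..} r)"
  have "(\<integral>\<^sup>+t\<in>{0<..}. ennreal (t ^ i * exp (- a * t) / (1 + t)) \<partial>lborel)
      = (\<integral>\<^sup>+t. \<integral>\<^sup>+r. ?f t r \<partial>lborel \<partial>lborel)"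
  proof (rule nn_integral_cong)
    fix t :: real
    show "ennreal (t ^ i * exp (- a * t) / (1 + t)) * indicator {0<..} t = (\<integral>\<^sup>+r. ?f t r \<partial>lborel)"
      using nn_integral_power_exp[of "1 + t" 0]
      by (cases "t > 0") (simp_all add: nn_integral_cmult ennreal_mult[symmetric])
  qed
  also have "\<dots> = (\<integral>\<^sup>+r. \<integral>\<^sup>+t. ?f t r \<partial>lborel \<partial>lborel)"
    by (rule lborel_pair.Fubini'[symmetric]) measurable
  also have "\<dots> = (\<integral>\<^sup>+r\<in>{0<..}. ennreal (fact i * exp (- r) / (a + r) ^ Suc i) \<partial>lborel)"
  proof (rule nn_integral_cong)
    fix r :: real
    have "(\<integral>\<^sup>+t. ?f t r \<partial>lborel) = (\<integral>\<^sup>+t. ennreal (exp (- r)) * indicator {0<..} r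
        * (ennreal (t ^ i * exp (- (a + r) * t)) * indicator {0<..} t) \<partial>lborel)"
      by (intro nn_integral_cong)
        (auto simp: ennreal_mult[symmetric] exp_add[symmetric] algebra_simps split: split_indicator)
    then show "(\<integral>\<^sup>+t. ?f t r \<partial>lborel)
        = ennreal (fact i * exp (- r) / (a + r) ^ Suc i) * indicator {0<..} r"
      using a nn_integral_power_exp[of "a + r" i]
      by (cases "r > 0")
        (simp_all add: nn_integral_cmult ennreal_mult[symmetric] mult.commute del: power_Suc)
  qed
  finally show ?thesis .
qed

lemma upper_inc_gamma_minus_nat:
  fixes a :: real
  assumes a: "a > 0"
  shows "upper_inc_gamma (- real i) a
    = enn2real (\<integral>\<^sup>+s\<in>{a<..}. ennreal (exp (- s) / s ^ Suc i) \<partial>lborel)"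
proof -
  have "s powr (- real i - 1) * exp (- s) = exp (- s) / s ^ Suc i" if "s > a" for s
  proof -
    have "s powr (- real i - 1) = s powr (- real (Suc i))"
      by (rule arg_cong[where f="(powr) s"]) simp
    also have "\<dots> = 1 / s ^ Suc i"
      using that a by (simp add: powr_minus powr_realpow divide_inverse del: power_Suc of_nat_Suc)
    finally show ?thesis
      by simp
  qed
  then have "upper_inc_gamma (- real i) a = (\<integral>s\<in>{a<..}. exp (- s) / s ^ Suc i \<partial>lborel)"
    unfolding upper_inc_gamma_def by (intro set_lebesgue_integral_cong) auto
  also have "\<dots> = enn2real (\<integral>\<^sup>+s\<in>{a<..}. ennreal (exp (- s) / s ^ Suc i) \<partial>lborel)"
    using a by (intro set_integral_eq_enn2real) auto
  finally show ?thesis .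
qed

lemma I1_zero_eq_upper_inc_gamma:
  fixes a b :: real
  assumes a: "a > 0"
  shows "I1 a b i 0 = fact i * exp a * upper_inc_gamma (- real i) a"
proof -
  have "I1 a b i 0 = enn2real (\<integral>\<^sup>+t\<in>{0<..}. ennreal (t ^ i * exp (- a * t) / (1 + t)) \<partial>lborel)"
    unfolding I1_def by (subst set_integral_eq_enn2real) (auto simp: add.commute)
  also have "(\<integral>\<^sup>+t\<in>{0<..}. ennreal (t ^ i * exp (- a * t) / (1 + t)) \<partial>lborel)
      = (\<integral>\<^sup>+r\<in>{0<..}. ennreal (fact i * exp (- r) / (a + r) ^ Suc i) \<partial>lborel)"
    by (rule nn_integral_power_exp_div_one_plus[OF a])
  also have "\<dots> = (\<integral>\<^sup>+s\<in>{a<..}. ennreal (fact i * exp (a - s) / s ^ Suc i) \<partial>lborel)"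
    by (subst nn_integral_real_affine[where c=1 and t="-a"])
      (auto intro!: nn_integral_cong split: split_indicator simp del: power_Suc)
  also have "\<dots> = (\<integral>\<^sup>+s. ennreal (fact i * exp a)
      * (ennreal (exp (- s) / s ^ Suc i) * indicator {a<..} s) \<partial>lborel)"
    using a by (intro nn_integral_cong)
      (auto simp: ennreal_mult[symmetric] exp_diff exp_minus field_simps
        split: split_indicator simp del: power_Suc)
  also have "\<dots> = ennreal (fact i * exp a) * (\<integral>\<^sup>+s\<in>{a<..}. ennreal (exp (- s) / s ^ Suc i) \<partial>lborel)"
    by (rule nn_integral_cmult) measurable
  finally show ?thesis
    by (simp add: enn2real_mult upper_inc_gamma_minus_nat[OF a])
qed

lemma (in prob_space) expectation_log_eq_sum_I1:
  fixes a b d :: real and c :: "'i \<Rightarrow> real"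
  assumes S: "random_variable borel S" "AE \<omega> in M. 0 \<le> S \<omega>" and a: "a > 0" and b: "b > 0"
    and tail: "\<And>t. t > 0 \<Longrightarrow>
      \<P>(\<omega> in M. t < S \<omega>) = (\<Sum>j\<in>J. c j * (t ^ m j * exp (- a * t) / (t + b) ^ n j))"
  shows "expectation (\<lambda>\<omega>. log d (1 + S \<omega>)) = log d (exp 1) * (\<Sum>j\<in>J. c j * I1 a b (m j) (n j))"
proof -
  let ?f = "\<lambda>j t. t ^ m j * exp (- a * t) / ((t + b) ^ n j * (t + 1))"
  have "expectation (\<lambda>\<omega>. log d (1 + S \<omega>)) = log d (exp 1) * expectation (\<lambda>\<omega>. ln (1 + S \<omega>))"
    by (simp add: log_def)
  also have "expectation (\<lambda>\<omega>. ln (1 + S \<omega>)) = (\<integral>t\<in>{0<..}. \<P>(\<omega> in M. t < S \<omega>) / (1 + t) \<partial>lborel)"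
    by (rule expectation_ln_one_plus_eq_tail_integral[OF S])
  also have "\<dots> = (\<integral>t\<in>{0<..}. (\<Sum>j\<in>J. c j * ?f j t) \<partial>lborel)"
    by (intro set_lebesgue_integral_cong) (simp_all add: tail sum_divide_distrib add.commute)
  also have "\<dots> = (\<Sum>j\<in>J. \<integral>t\<in>{0<..}. c j * ?f j t \<partial>lborel)"
    by (intro set_integral_sum set_integrable_mult_right set_integrable_I1 a b)
  also have "\<dots> = (\<Sum>j\<in>J. c j * I1 a b (m j) (n j))"
    by (simp only: I1_def set_integral_mult_right)
  finally show ?thesis .
qed

subsection \<open>Erlang signal and exponential interference\<close>

lemma (in prob_space) erlang_distributed_AE_nonneg:
  "distributed M lborel X (erlang_density k l) \<Longrightarrow> AE \<omega> in M. 0 \<le> X \<omega>"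
  by (subst distributed_AE2) (auto simp: erlang_density_def)

lemma (in prob_space) erlang_distributed_tail:
  assumes "distributed M lborel X (erlang_density k l)" "0 < l" "0 \<le> a"
  shows "\<P>(\<omega> in M. a < X \<omega>) = (\<Sum>i\<le>k. (l * a) ^ i * exp (- l * a) / fact i)"
  using erlang_distributed_gt[OF assms] assms(3) by (simp add: erlang_CDF_def)

lemma (in prob_space) expectation_log_erlang:
  assumes X: "distributed M lborel X (erlang_density n 1)" and \<gamma>: "\<gamma> > 0"
  shows "expectation (\<lambda>\<omega>. log 2 (1 + \<gamma> * X \<omega>)) = R_BF \<gamma> (Suc n)"
proof -
  have "expectation (\<lambda>\<omega>. log 2 (1 + \<gamma> * X \<omega>))
      = log 2 (exp 1) * (\<Sum>i\<le>n. 1 / (\<gamma> ^ i * fact i) * I1 (1 / \<gamma>) 1 i 0)"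
  proof (rule expectation_log_eq_sum_I1)
    show "random_variable borel (\<lambda>\<omega>. \<gamma> * X \<omega>)"
      using distributed_measurable[OF X] by simp
    show "AE \<omega> in M. 0 \<le> \<gamma> * X \<omega>"
      using erlang_distributed_AE_nonneg[OF X] by eventually_elim (use \<gamma> in simp)
    fix t :: real assume "t > 0"
    have "\<P>(\<omega> in M. t < \<gamma> * X \<omega>) = \<P>(\<omega> in M. t / \<gamma> < X \<omega>)"
      using \<gamma> by (simp add: field_simps)
    also have "\<dots> = (\<Sum>i\<le>n. (t / \<gamma>) ^ i * exp (- (t / \<gamma>)) / fact i)"
      using erlang_distributed_tail[OF X, of "t / \<gamma>"] \<open>t > 0\<close> \<gamma> by simp
    finally show "\<P>(\<omega> in M. t < \<gamma> * X \<omega>)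
        = (\<Sum>i\<le>n. 1 / (\<gamma> ^ i * fact i) * (t ^ i * exp (- (1 / \<gamma>) * t) / (t + 1) ^ 0))"
      by (simp add: power_divide)
  qed (use \<gamma> in simp_all)
  also have "\<dots> = R_BF \<gamma> (Suc n)"
    using \<gamma>
    by (simp add: R_BF_def I1_zero_eq_upper_inc_gamma lessThan_Suc_atMost sum_distrib_left
        mult.assoc)
  finally show ?thesis .
qed

lemma erlang_density_mult_exp:
  assumes "l + b \<noteq> 0"
  shows "erlang_density k l x * exp (- b * x) = (l / (l + b)) ^ Suc k * erlang_density k (l + b) x"
proof (cases "x < 0")
  case False
  have pow: "l ^ Suc k = (l / (l + b)) ^ Suc k * (l + b) ^ Suc k"
    using assms by (simp add: power_divide del: power_Suc)
  have exp: "exp (- l * x) * exp (- b * x) = exp (- (l + b) * x)"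
    by (simp add: exp_add[symmetric] algebra_simps)
  have "erlang_density k l x * exp (- b * x)
      = l ^ Suc k * x ^ k * (exp (- l * x) * exp (- b * x)) / fact k"
    using False by (simp add: erlang_density_def)
  also have "\<dots> = (l / (l + b)) ^ Suc k * (l + b) ^ Suc k * x ^ k * exp (- (l + b) * x) / fact k"
    by (simp only: pow exp)
  also have "\<dots> = (l / (l + b)) ^ Suc k * erlang_density k (l + b) x"
    using False by (simp add: erlang_density_def)
  finally show ?thesis .
qed (simp add: erlang_density_def)

lemma (in prob_space) has_bochner_integral_erlang_power_exp:
  assumes X: "distributed M lborel X (erlang_density k l)" and l: "0 < l" and b: "0 < l + b"
  shows "has_bochner_integral M (\<lambda>\<omega>. X \<omega> ^ i * exp (- b * X \<omega>))
    ((l / (l + b)) ^ Suc k * (fact (k + i) / (fact k * (l + b) ^ i)))"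
proof (rule has_bochner_integral_nn_integral)
  let ?c = "(l / (l + b)) ^ Suc k"
  have "(\<integral>\<^sup>+\<omega>. ennreal (X \<omega> ^ i * exp (- b * X \<omega>)) \<partial>M)
      = (\<integral>\<^sup>+x. ennreal (erlang_density k l x) * ennreal (x ^ i * exp (- b * x)) \<partial>lborel)"
    by (subst distributed_nn_integral[OF X]) auto
  also have "\<dots> = (\<integral>\<^sup>+x. ennreal ?c * ennreal (erlang_density k (l + b) x * x ^ i) \<partial>lborel)"
  proof (rule nn_integral_cong)
    fix x
    have "erlang_density k l x * (x ^ i * exp (- b * x))
        = erlang_density k l x * exp (- b * x) * x ^ i"
      by (simp only: mult_ac)
    also have "erlang_density k l x * exp (- b * x) = ?c * erlang_density k (l + b) x"
      by (rule erlang_density_mult_exp) (use b in simp)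
    also have "\<dots> * x ^ i = ?c * (erlang_density k (l + b) x * x ^ i)"
      by (rule mult.assoc)
    finally have "ennreal (erlang_density k l x * (x ^ i * exp (- b * x)))
        = ennreal (?c * (erlang_density k (l + b) x * x ^ i))"
      by (rule arg_cong)
    then show "ennreal (erlang_density k l x) * ennreal (x ^ i * exp (- b * x))
        = ennreal ?c * ennreal (erlang_density k (l + b) x * x ^ i)"
      using l b
      by (simp only: ennreal_mult' erlang_density_nonneg zero_le_power divide_nonneg_pos
          less_imp_le)
  qed
  also have "\<dots> = ennreal ?c * ennreal (fact (k + i) / (fact k * (l + b) ^ i))"
    by (subst nn_integral_cmult) (simp_all only: nn_integral_erlang_ith_moment[OF b], measurable)
  also have "\<dots> = ennreal (?c * (fact (k + i) / (fact k * (l + b) ^ i)))"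
    using l b by (intro ennreal_mult'[symmetric]) simp
  finally show "(\<integral>\<^sup>+\<omega>. ennreal (X \<omega> ^ i * exp (- b * X \<omega>)) \<partial>M)
      = ennreal (?c * (fact (k + i) / (fact k * (l + b) ^ i)))" .
  show "AE \<omega> in M. 0 \<le> X \<omega> ^ i * exp (- b * X \<omega>)"
    using erlang_distributed_AE_nonneg[OF X] by eventually_elim simp
qed (use distributed_measurable[OF X] l b in auto)

lemma (in prob_space) has_bochner_integral_exponential_affine_power_exp:
  assumes Y: "distributed M lborel Y (exponential_density 1)" and b: "b > - 1"
  shows "has_bochner_integral M (\<lambda>\<omega>. (1 + \<gamma> * Y \<omega>) ^ i * exp (- b * Y \<omega>))
    (\<Sum>l\<le>i. real (i choose l) * \<gamma> ^ l * (fact l / (1 + b) ^ Suc l))"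
proof -
  have "has_bochner_integral M (\<lambda>\<omega>. Y \<omega> ^ l * exp (- b * Y \<omega>)) (fact l / (1 + b) ^ Suc l)" for l
    using has_bochner_integral_erlang_power_exp[OF Y, of b l] b by simp
  then have "has_bochner_integral M
      (\<lambda>\<omega>. \<Sum>l\<le>i. real (i choose l) * \<gamma> ^ l * (Y \<omega> ^ l * exp (- b * Y \<omega>)))
      (\<Sum>l\<le>i. real (i choose l) * \<gamma> ^ l * (fact l / (1 + b) ^ Suc l))"
    by (intro has_bochner_integral_sum has_bochner_integral_mult_right)
  moreover have "(\<Sum>l\<le>i. real (i choose l) * \<gamma> ^ l * (y ^ l * exp (- b * y)))
      = (1 + \<gamma> * y) ^ i * exp (- b * y)" for y
    using binomial_ring[of "\<gamma> * y" 1 i]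
    by (simp add: add.commute sum_distrib_right power_mult_distrib mult.assoc)
  ultimately show ?thesis
    by (simp only:)
qed

lemma (in prob_space) indep_var_prob_eq_expectation:
  assumes indep: "indep_var S X T Y" and A [measurable]: "A \<in> sets (S \<Otimes>\<^sub>M T)"
  shows "\<P>(\<omega> in M. (X \<omega>, Y \<omega>) \<in> A) = expectation (\<lambda>\<omega>. \<P>(\<omega>' in M. (X \<omega>', Y \<omega>) \<in> A))"
proof -
  note [measurable] = indep_var_rv1[OF indep] and Y [measurable] = indep_var_rv2[OF indep]
  interpret X: prob_space "distr M S X" by (rule prob_space_distr) measurable
  interpret Y: prob_space "distr M T Y" by (rule prob_space_distr) measurable
  interpret pair_sigma_finite "distr M S X" "distr M T Y" ..
  have "emeasure M {\<omega> \<in> space M. (X \<omega>, Y \<omega>) \<in> A}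
      = emeasure (distr M (S \<Otimes>\<^sub>M T) (\<lambda>\<omega>. (X \<omega>, Y \<omega>))) A"
    by (subst emeasure_distr) (auto intro!: arg_cong[where f="emeasure M"])
  also have "\<dots> = emeasure (distr M S X \<Otimes>\<^sub>M distr M T Y) A"
    using indep by (simp add: indep_var_distribution_eq)
  also have "\<dots> = (\<integral>\<^sup>+\<omega>. emeasure (distr M S X) ((\<lambda>x. (x, Y \<omega>)) -` A) \<partial>M)"
    by (subst emeasure_pair_measure_alt2)
      (auto intro!: nn_integral_distr measurable_emeasure_Pair2 cong: measurable_cong_sets)
  also have "\<dots> = (\<integral>\<^sup>+\<omega>. ennreal (\<P>(\<omega>' in M. (X \<omega>', Y \<omega>) \<in> A)) \<partial>M)"
    by (intro nn_integral_cong, subst emeasure_distr)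
      (auto simp: emeasure_eq_measure measurable_space[OF Y]
        intro!: arg_cong[where f=prob] sets_Pair2[OF A])
  also have "enn2real \<dots> = expectation (\<lambda>\<omega>. \<P>(\<omega>' in M. (X \<omega>', Y \<omega>) \<in> A))"
    by (rule integral_eq_nn_integral[symmetric]) (auto simp: measure_def)
  finally show ?thesis
    by (simp add: measure_def)
qed

lemma sinr_tail_summand:
  fixes \<gamma>1 \<gamma>2 t :: real
  assumes \<gamma>: "\<gamma>1 > 0" "\<gamma>2 > 0" and "t > 0" "l \<le> i"
  shows "(t / \<gamma>1) ^ i * exp (- (t / \<gamma>1)) / fact i
      * (real (i choose l) * \<gamma>2 ^ l * (fact l / (1 + t / \<gamma>1 * \<gamma>2) ^ Suc l))
    = \<gamma>1 powi (int l + 1 - int i) / (\<gamma>2 * fact (i - l))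
      * (t ^ i * exp (- (1 / \<gamma>1) * t) / (t + \<gamma>1 / \<gamma>2) ^ (l + 1))"
proof -
  have binomial: "real (i choose l) * fact l / fact i = 1 / fact (i - l)"
    using binomial_fact[OF \<open>l \<le> i\<close>, where 'a=real] by (simp add: field_simps)
  have factor: "1 + t / \<gamma>1 * \<gamma>2 = (\<gamma>2 / \<gamma>1) * (t + \<gamma>1 / \<gamma>2)"
    using \<gamma> by (simp add: field_simps)
  have powi: "\<gamma>1 powi (int l + 1 - int i) = \<gamma>1 ^ Suc l / \<gamma>1 ^ i"
    using \<gamma> by (simp add: power_int_diff power_int_add)
  have "(t / \<gamma>1) ^ i * exp (- (t / \<gamma>1)) / fact i
        * (real (i choose l) * \<gamma>2 ^ l * (fact l / (1 + t / \<gamma>1 * \<gamma>2) ^ Suc l))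
      = (real (i choose l) * fact l / fact i)
        * ((t / \<gamma>1) ^ i * exp (- (t / \<gamma>1)) * \<gamma>2 ^ l / (1 + t / \<gamma>1 * \<gamma>2) ^ Suc l)"
    by (simp add: mult_ac)
  also have "\<dots> = \<gamma>1 powi (int l + 1 - int i) / (\<gamma>2 * fact (i - l))
      * (t ^ i * exp (- (1 / \<gamma>1) * t) / (t + \<gamma>1 / \<gamma>2) ^ (l + 1))"
    unfolding binomial factor powi using \<gamma> \<open>t > 0\<close>
    by (simp add: power_divide power_mult_distrib mult_ac)
  finally show ?thesis .
qed

lemma (in prob_space) sinr_tail_given_interference:
  assumes X: "distributed M lborel X (erlang_density n 1)"
    and "\<gamma>1 > 0" "\<gamma>2 \<ge> 0" "t \<ge> 0" "y \<ge> 0"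
  shows "\<P>(\<omega> in M. t < \<gamma>1 * X \<omega> / (1 + \<gamma>2 * y)) = (\<Sum>i\<le>n. (t / \<gamma>1) ^ i * exp (- (t / \<gamma>1)) / fact i
    * ((1 + \<gamma>2 * y) ^ i * exp (- (t / \<gamma>1 * \<gamma>2) * y)))"
proof -
  define c where "c = t / \<gamma>1"
  have pos: "1 + \<gamma>2 * y > 0" and "c \<ge> 0"
    using assms by (simp_all add: add_pos_nonneg c_def)
  have "\<P>(\<omega> in M. t < \<gamma>1 * X \<omega> / (1 + \<gamma>2 * y)) = \<P>(\<omega> in M. c * (1 + \<gamma>2 * y) < X \<omega>)"
    using \<open>\<gamma>1 > 0\<close> pos by (simp add: c_def field_simps)
  also have "\<dots> = (\<Sum>i\<le>n. (c * (1 + \<gamma>2 * y)) ^ i * exp (- (c * (1 + \<gamma>2 * y))) / fact i)"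
    using erlang_distributed_tail[OF X, of "c * (1 + \<gamma>2 * y)"] pos \<open>c \<ge> 0\<close> by simp
  also have "exp (- (c * (1 + \<gamma>2 * y))) = exp (- c) * exp (- (c * \<gamma>2) * y)"
    by (simp add: exp_add[symmetric] algebra_simps)
  also have "(\<Sum>i\<le>n. (c * (1 + \<gamma>2 * y)) ^ i * (exp (- c) * exp (- (c * \<gamma>2) * y)) / fact i)
      = (\<Sum>i\<le>n. c ^ i * exp (- c) / fact i * ((1 + \<gamma>2 * y) ^ i * exp (- (c * \<gamma>2) * y)))"
    by (simp add: power_mult_distrib mult_ac)
  finally show ?thesis
    by (simp only: c_def)
qed

lemma (in prob_space) sinr_tail:
  assumes X: "distributed M lborel X (erlang_density n 1)"
    and Y: "distributed M lborel Y (exponential_density 1)"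
    and indep: "indep_var borel X borel Y" and \<gamma>: "\<gamma>1 > 0" "\<gamma>2 > 0" and t: "t > 0"
  shows "\<P>(\<omega> in M. t < \<gamma>1 * X \<omega> / (1 + \<gamma>2 * Y \<omega>))
    = (\<Sum>i\<le>n. \<Sum>l\<le>i. \<gamma>1 powi (int l + 1 - int i) / (\<gamma>2 * fact (i - l))
        * (t ^ i * exp (- (1 / \<gamma>1) * t) / (t + \<gamma>1 / \<gamma>2) ^ (l + 1)))"
proof -
  define c where "c = t / \<gamma>1"
  have c: "c > 0"
    using t \<gamma> by (simp add: c_def)
  note [measurable] = indep_var_rv1[OF indep] indep_var_rv2[OF indep]
  have "{p \<in> space (borel \<Otimes>\<^sub>M borel). t < \<gamma>1 * fst p / (1 + \<gamma>2 * snd p)} \<in> sets (borel \<Otimes>\<^sub>M borel)"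
    by measurable
  from indep_var_prob_eq_expectation[OF indep this]
  have "\<P>(\<omega> in M. t < \<gamma>1 * X \<omega> / (1 + \<gamma>2 * Y \<omega>))
      = expectation (\<lambda>\<omega>. \<P>(\<omega>' in M. t < \<gamma>1 * X \<omega>' / (1 + \<gamma>2 * Y \<omega>)))"
    by (simp add: space_pair_measure)
  also have "\<dots> = expectation (\<lambda>\<omega>. \<Sum>i\<le>n. c ^ i * exp (- c) / fact i
      * ((1 + \<gamma>2 * Y \<omega>) ^ i * exp (- (c * \<gamma>2) * Y \<omega>)))"
  proof (rule integral_cong_AE)
    show "AE \<omega> in M. \<P>(\<omega>' in M. t < \<gamma>1 * X \<omega>' / (1 + \<gamma>2 * Y \<omega>))
        = (\<Sum>i\<le>n. c ^ i * exp (- c) / fact i * ((1 + \<gamma>2 * Y \<omega>) ^ i * exp (- (c * \<gamma>2) * Y \<omega>)))"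
      using erlang_distributed_AE_nonneg[OF Y]
      by eventually_elim (use \<gamma> t in \<open>simp add: sinr_tail_given_interference[OF X] c_def\<close>)
  qed (auto simp: measure_def)
  also have "\<dots> = (\<Sum>i\<le>n. c ^ i * exp (- c) / fact i
      * (\<Sum>l\<le>i. real (i choose l) * \<gamma>2 ^ l * (fact l / (1 + c * \<gamma>2) ^ Suc l)))"
    using c \<gamma> by (intro has_bochner_integral_integral_eq has_bochner_integral_sum
        has_bochner_integral_mult_right has_bochner_integral_exponential_affine_power_exp[OF Y])
      (simp add: add_pos_pos less_trans[OF _ mult_pos_pos])
  also have "\<dots> = (\<Sum>i\<le>n. \<Sum>l\<le>i. \<gamma>1 powi (int l + 1 - int i) / (\<gamma>2 * fact (i - l))
        * (t ^ i * exp (- (1 / \<gamma>1) * t) / (t + \<gamma>1 / \<gamma>2) ^ (l + 1)))"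
    unfolding c_def sum_distrib_left using \<gamma> t by (intro sum.cong refl sinr_tail_summand) auto
  finally show ?thesis .
qed

lemma (in prob_space) expectation_log_sinr:
  assumes X: "distributed M lborel X (erlang_density n 1)"
    and Y: "distributed M lborel Y (exponential_density 1)"
    and indep: "indep_var borel X borel Y" and \<gamma>: "\<gamma>1 > 0" "\<gamma>2 > 0"
  shows "expectation (\<lambda>\<omega>. log 2 (1 + \<gamma>1 * X \<omega> / (1 + \<gamma>2 * Y \<omega>))) = R_I2 \<gamma>1 \<gamma>2 (Suc n)"
proof -
  let ?J = "SIGMA i:{..n}. {..i}"
  let ?c = "\<lambda>(i, l). \<gamma>1 powi (int l + 1 - int i) / (\<gamma>2 * fact (i - l))"
  have "expectation (\<lambda>\<omega>. log 2 (1 + \<gamma>1 * X \<omega> / (1 + \<gamma>2 * Y \<omega>)))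
      = log 2 (exp 1) * (\<Sum>j\<in>?J. ?c j * I1 (1 / \<gamma>1) (\<gamma>1 / \<gamma>2) (fst j) (snd j + 1))"
  proof (rule expectation_log_eq_sum_I1)
    show "random_variable borel (\<lambda>\<omega>. \<gamma>1 * X \<omega> / (1 + \<gamma>2 * Y \<omega>))"
      using indep_var_rv1[OF indep] indep_var_rv2[OF indep] by simp
    show "AE \<omega> in M. 0 \<le> \<gamma>1 * X \<omega> / (1 + \<gamma>2 * Y \<omega>)"
      using erlang_distributed_AE_nonneg[OF X] erlang_distributed_AE_nonneg[OF Y]
      by eventually_elim (use \<gamma> in \<open>simp add: add_nonneg_nonneg\<close>)
    show "\<P>(\<omega> in M. t < \<gamma>1 * X \<omega> / (1 + \<gamma>2 * Y \<omega>)) = (\<Sum>j\<in>?J. ?c j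
        * (t ^ fst j * exp (- (1 / \<gamma>1) * t) / (t + \<gamma>1 / \<gamma>2) ^ (snd j + 1)))" if "t > 0" for t
      unfolding sinr_tail[OF X Y indep \<gamma> that] by (subst sum.Sigma) (auto simp: case_prod_beta')
  qed (use \<gamma> in simp_all)
  also have "\<dots> = R_I2 \<gamma>1 \<gamma>2 (Suc n)"
    unfolding R_I2_def lessThan_Suc_atMost by (subst sum.Sigma) (auto simp: case_prod_beta')
  finally show ?thesis .
qed

subsection \<open>Gains of the precoders\<close>

lemma cinner_diff_right: "cinner n x (\<lambda>k. y k - z k) = cinner n x y - cinner n x z"
  by (simp add: cinner_def algebra_simps sum_subtractf)

lemma cinner_scale_right: "cinner n x (\<lambda>k. y k * a) = cinner n x y * a"
  by (simp add: cinner_def sum_distrib_right mult.assoc)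

lemma cinner_divide_right: "cinner n x (\<lambda>k. y k / a) = cinner n x y / a"
  by (simp add: cinner_def sum_divide_distrib)

lemma cinner_commute: "cinner n x y = cnj (cinner n y x)"
  by (simp add: cinner_def mult.commute)

lemma cinner_bf_prec_own: "(cmod (cinner n h (bf_prec n h)))\<^sup>2 = (vnorm n h)\<^sup>2"
  by (simp add: bf_prec_def cinner_divide_right cinner_self norm_divide power2_eq_square)

lemma cinner_bf_prec_cross:
  "(cmod (cinner n g (bf_prec n h)))\<^sup>2 = (cmod (coord_along n h g))\<^sup>2"
  by (simp add: bf_prec_def cinner_divide_right coord_along_def cinner_commute[of n g h]
      norm_divide)

definition zf_residual :: "nat \<Rightarrow> (nat \<Rightarrow> complex) \<Rightarrow> (nat \<Rightarrow> complex) \<Rightarrow> nat \<Rightarrow> complex" where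
  "zf_residual n g h = (\<lambda>k. h k - g k * (cinner n g h / of_real ((vnorm n g)\<^sup>2)))"

lemma ic_prec_eq_zf_residual:
  "ic_prec n g h = (\<lambda>k. zf_residual n g h k / of_real (vnorm n (zf_residual n g h)))"
  unfolding ic_prec_def zf_residual_def Let_def by simp

lemma cinner_zf_residual_right:
  "cinner n x (zf_residual n g h)
    = cinner n x h - cinner n x g * (cinner n g h / of_real ((vnorm n g)\<^sup>2))"
  unfolding zf_residual_def by (simp only: cinner_diff_right cinner_scale_right)

lemma cinner_zf_residual_eq_0: "cinner n g (zf_residual n g h) = 0"
  by (cases "vnorm n g = 0")
    (simp_all add: cinner_zf_residual_right cinner_eq_0_if_vnorm_eq_0 cinner_self)

lemma cinner_ic_prec_cross: "cinner n g (ic_prec n g h) = 0"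
  unfolding ic_prec_eq_zf_residual cinner_divide_right cinner_zf_residual_eq_0 by simp

lemma cinner_own_zf_residual: "cinner n h (zf_residual n g h) = of_real (rejection_energy n g h)"
proof -
  have "cinner n h g * cinner n g h = of_real ((cmod (cinner n g h))\<^sup>2)"
    by (subst cinner_commute) (simp only: complex_norm_square mult.commute)
  then show ?thesis
    by (simp add: cinner_zf_residual_right cinner_self rejection_energy_def coord_along_def
        norm_divide power_divide)
qed

lemma vnorm_zf_residual_square: "(vnorm n (zf_residual n g h))\<^sup>2 = rejection_energy n g h"
proof -
  let ?w = "zf_residual n g h"
  have "complex_of_real ((vnorm n ?w)\<^sup>2)
      = cinner n ?w h - cinner n ?w g * (cinner n g h / of_real ((vnorm n g)\<^sup>2))"
    using cinner_zf_residual_right[of n ?w g h] by (simp only: cinner_self[of n ?w])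
  also have "cinner n ?w g = 0"
    by (subst cinner_commute) (simp add: cinner_zf_residual_eq_0)
  also have "cinner n ?w h = of_real (rejection_energy n g h)"
    by (subst cinner_commute) (simp add: cinner_own_zf_residual)
  finally have "complex_of_real ((vnorm n ?w)\<^sup>2) = of_real (rejection_energy n g h)"
    by simp
  then show ?thesis
    by (simp only: of_real_eq_iff)
qed

lemma cinner_ic_prec_own: "(cmod (cinner n h (ic_prec n g h)))\<^sup>2 = rejection_energy n g h"
proof -
  have "cinner n h (ic_prec n g h)
      = of_real ((vnorm n (zf_residual n g h))\<^sup>2 / vnorm n (zf_residual n g h))"
    by (simp add: ic_prec_eq_zf_residual cinner_divide_right cinner_own_zf_residual
        vnorm_zf_residual_square)
  also have "\<dots> = of_real (vnorm n (zf_residual n g h))"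
    by (simp add: power2_eq_square)
  finally show ?thesis
    by (simp add: vnorm_zf_residual_square)
qed

subsection \<open>The channel space\<close>

abbreviation chan_vec :: "nat \<Rightarrow> nat \<Rightarrow> nat \<Rightarrow> (nat \<times> nat \<times> nat \<Rightarrow> complex) \<Rightarrow> nat \<Rightarrow> complex" where
  "chan_vec n i j \<omega> \<equiv> restrict (chan \<omega> i j) {..<n}"

lemma measurable_chan_vec:
  "{i} \<times> {j} \<times> {..<n} \<subseteq> K \<Longrightarrow> chan_vec n i j \<in> measurable (PiM K (\<lambda>_. CN_std)) (CN_vec n)"
  unfolding chan_def by (intro measurable_restrict measurable_component_singleton) auto

lemma measurable_chan_vec_chan_space [measurable]:
  "i \<in> {1, 2} \<Longrightarrow> j \<in> {1, 2} \<Longrightarrow> chan_vec n i j \<in> measurable (chan_space n) (CN_vec n)"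
  unfolding chan_space_def by (rule measurable_chan_vec) auto

lemma chan_vec_restrict: "{i} \<times> {j} \<times> {..<n} \<subseteq> K \<Longrightarrow> chan_vec n i j (restrict \<omega> K) = chan_vec n i j \<omega>"
  by (auto simp: chan_def restrict_def fun_eq_iff)

lemma prob_space_chan_space: "prob_space (chan_space n)"
  unfolding chan_space_def by (rule prob_space_PiM) (rule prob_space_CN_std)

lemma distr_chan_vec:
  "i \<in> {1, 2} \<Longrightarrow> j \<in> {1, 2} \<Longrightarrow> distr (chan_space n) (CN_vec n) (chan_vec n i j) = CN_vec n"
  unfolding chan_space_def chan_def
  by (rule distr_PiM_reindex[where f="\<lambda>k. (i, j, k)" and M="\<lambda>_. CN_std"])
    (auto simp: inj_on_def prob_space_CN_std)

lemma distr_chan_vec_pair: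
  assumes ij: "i \<in> {1, 2}" "j \<in> {1, 2}" "i' \<in> {1, 2}" "j' \<in> {1, 2}" "(i, j) \<noteq> (i', j')"
  shows "distr (chan_space n) (CN_vec n \<Otimes>\<^sub>M CN_vec n) (\<lambda>\<omega>. (chan_vec n i j \<omega>, chan_vec n i' j' \<omega>))
    = CN_vec n \<Otimes>\<^sub>M CN_vec n"
proof -
  interpret prob_space "chan_space n" by (rule prob_space_chan_space)
  let ?J = "{i} \<times> {j} \<times> {..<n}" and ?K = "{i'} \<times> {j'} \<times> {..<n}"
  have "indep_var (CN_vec n) (\<lambda>\<omega>. chan_vec n i j (restrict \<omega> ?J))
      (CN_vec n) (\<lambda>\<omega>. chan_vec n i' j' (restrict \<omega> ?K))"
    unfolding chan_space_def
  proof (rule indep_var_PiM_restrict)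
    show "chan_vec n i j \<in> measurable (PiM ?J (\<lambda>_. CN_std)) (CN_vec n)"
        "chan_vec n i' j' \<in> measurable (PiM ?K (\<lambda>_. CN_std)) (CN_vec n)"
      by (rule measurable_chan_vec, rule order_refl)+
  qed (use ij in \<open>auto intro: prob_space_CN_std\<close>)
  then have "indep_var (CN_vec n) (chan_vec n i j) (CN_vec n) (chan_vec n i' j')"
    by (simp only: chan_vec_restrict[OF order_refl])
  then show ?thesis
    using ij by (simp add: indep_var_distribution_eq distr_chan_vec)
qed

definition signal_gain :: "nat \<Rightarrow> strategy \<Rightarrow> (nat \<times> nat \<times> nat \<Rightarrow> complex) \<Rightarrow> real" where
  "signal_gain n s \<omega> = (case s of BF \<Rightarrow> (vnorm n (chan_vec n 1 1 \<omega>))\<^sup>2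
     | IC \<Rightarrow> rejection_energy n (chan_vec n 2 1 \<omega>) (chan_vec n 1 1 \<omega>))"

definition interference_gain :: "nat \<Rightarrow> strategy \<Rightarrow> (nat \<times> nat \<times> nat \<Rightarrow> complex) \<Rightarrow> real" where
  "interference_gain n s \<omega> = (case s of
     BF \<Rightarrow> (cmod (coord_along n (chan_vec n 2 2 \<omega>) (chan_vec n 1 2 \<omega>)))\<^sup>2 | IC \<Rightarrow> 0)"

lemma cinner_restrict: "cinner n (restrict x {..<n}) (restrict y {..<n}) = cinner n x y"
  by (simp add: cinner_def)

lemma vnorm_restrict: "vnorm n (restrict x {..<n}) = vnorm n x"
  by (simp add: vnorm_def)

lemma SINR1_eq_gains:
  "SINR1 n P Q s1 s2 \<omega> = P * signal_gain n s1 \<omega> / (1 + Q * interference_gain n s2 \<omega>)"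
  by (cases s1; cases s2)
    (simp_all add: SINR1_def prec_def signal_gain_def interference_gain_def rejection_energy_def
      coord_along_def cinner_restrict vnorm_restrict cinner_bf_prec_own cinner_bf_prec_cross
      cinner_ic_prec_own cinner_ic_prec_cross)

lemma distributed_signal_gain_BF:
  "distributed (chan_space (Suc n)) lborel (signal_gain (Suc n) BF) (erlang_density n 1)"
proof -
  let ?m = "Suc n"
  have "distributed (distr (chan_space ?m) (CN_vec ?m) (chan_vec ?m 1 1)) lborel
      (\<lambda>h. (vnorm ?m h)\<^sup>2) (erlang_density n 1)"
    by (subst distr_chan_vec) (simp_all only: insert_iff simp_thms distributed_CN_vec_vnorm_square)
  then show ?thesis
    by (subst (asm) distributed_distr_iff) (simp_all add: signal_gain_def[abs_def])
qed

lemma distributed_signal_gain_IC: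
  "distributed (chan_space (Suc (Suc n))) lborel (signal_gain (Suc (Suc n)) IC)
    (erlang_density n 1)"
proof -
  let ?m = "Suc (Suc n)"
  have "distributed (distr (chan_space ?m) (CN_vec ?m \<Otimes>\<^sub>M CN_vec ?m)
      (\<lambda>\<omega>. (chan_vec ?m 2 1 \<omega>, chan_vec ?m 1 1 \<omega>)))
    lborel (\<lambda>(g, h). rejection_energy ?m g h) (erlang_density n 1)"
    by (subst distr_chan_vec_pair) (simp_all add: distributed_rejection_energy)
  then show ?thesis
    by (subst (asm) distributed_distr_iff) (simp_all add: signal_gain_def[abs_def] case_prod_beta')
qed

lemma distributed_interference_gain_BF:
  "distributed (chan_space (Suc n)) lborel (interference_gain (Suc n) BF) (exponential_density 1)"
proof -
  let ?m = "Suc n"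
  have "distributed (distr (chan_space ?m) (CN_vec ?m \<Otimes>\<^sub>M CN_vec ?m)
      (\<lambda>\<omega>. (chan_vec ?m 2 2 \<omega>, chan_vec ?m 1 2 \<omega>)))
    lborel (\<lambda>(g, h). (cmod (coord_along ?m g h))\<^sup>2) (exponential_density 1)"
    by (subst distr_chan_vec_pair) (simp_all add: distributed_coord_along_square)
  then show ?thesis
    by (subst (asm) distributed_distr_iff)
      (simp_all add: interference_gain_def[abs_def] case_prod_beta')
qed

lemma indep_var_signal_gain_interference_gain:
  "prob_space.indep_var (chan_space n) borel (signal_gain n s1) borel (interference_gain n s2)"
proof -
  \<comment> \<open>the signal involves only channels from base station 1, the interference only those from 2\<close>
  let ?K = "\<lambda>j::nat. {1, 2} \<times> {j} \<times> {..<n}"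
  have [measurable]: "chan_vec n 1 j \<in> measurable (PiM (?K j) (\<lambda>_. CN_std)) (CN_vec n)"
      "chan_vec n 2 j \<in> measurable (PiM (?K j) (\<lambda>_. CN_std)) (CN_vec n)" for j
    by (rule measurable_chan_vec, force)+
  have "prob_space.indep_var (chan_space n)
      borel (\<lambda>\<omega>. signal_gain n s1 (restrict \<omega> (?K 1)))
      borel (\<lambda>\<omega>. interference_gain n s2 (restrict \<omega> (?K 2)))"
    unfolding chan_space_def
  proof (rule indep_var_PiM_restrict)
    show "signal_gain n s1 \<in> borel_measurable (PiM (?K 1) (\<lambda>_. CN_std))"
      unfolding signal_gain_def[abs_def] by (cases s1; simp only: strategy.case; measurable)
    show "interference_gain n s2 \<in> borel_measurable (PiM (?K 2) (\<lambda>_. CN_std))"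
      unfolding interference_gain_def[abs_def] by (cases s2; simp only: strategy.case; measurable)
  qed (auto intro: prob_space_CN_std)
  moreover have "chan_vec n 1 j (restrict \<omega> (?K j)) = chan_vec n 1 j \<omega>"
      "chan_vec n 2 j (restrict \<omega> (?K j)) = chan_vec n 2 j \<omega>" for j \<omega>
    by (rule chan_vec_restrict, force)+
  then have "signal_gain n s1 (restrict \<omega> (?K 1)) = signal_gain n s1 \<omega>"
      "interference_gain n s2 (restrict \<omega> (?K 2)) = interference_gain n s2 \<omega>" for \<omega>
    by (simp_all only: signal_gain_def interference_gain_def)
  ultimately show ?thesis
    by (simp only:)
qed

subsection \<open>Rates\<close>

lemma rate1_cross_BF_eq_R_I2:
  assumes "P > 0" "Q > 0"
    and "distributed (chan_space (Suc n)) lborel (signal_gain (Suc n) s) (erlang_density m 1)"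
  shows "rate1 (Suc n) P Q s BF = R_I2 P Q (Suc m)"
  unfolding rate1_def SINR1_eq_gains
  by (rule prob_space.expectation_log_sinr) (fact assms prob_space_chan_space
      distributed_interference_gain_BF indep_var_signal_gain_interference_gain)+

lemma rate1_cross_IC_eq_R_BF:
  assumes "P > 0" and "distributed (chan_space n) lborel (signal_gain n s) (erlang_density m 1)"
  shows "rate1 n P Q s IC = R_BF P (Suc m)"
  using prob_space.expectation_log_erlang[OF prob_space_chan_space assms(2,1)]
  by (simp add: rate1_def SINR1_eq_gains interference_gain_def)

theorem theorem1:
  fixes Nt :: nat and P11 P12 :: real
  assumes "Nt \<ge> 2" and "P11 > 0" and "P12 > 0"
  shows "rate1 Nt P11 P12 BF BF = R_I2 P11 P12 Nt
       \<and> rate1 Nt P11 P12 BF IC = R_BF P11 Nt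
       \<and> rate1 Nt P11 P12 IC IC = R_BF P11 (Nt - 1)
       \<and> rate1 Nt P11 P12 IC BF = R_I2 P11 P12 (Nt - 1)"
proof -
  obtain n where Nt: "Nt = Suc (Suc n)"
    using \<open>Nt \<ge> 2\<close> by (metis Suc_le_D Suc_le_mono numeral_2_eq_2)
  note positive = \<open>P11 > 0\<close> \<open>P12 > 0\<close>
  have "rate1 Nt P11 P12 BF BF = R_I2 P11 P12 Nt"
    unfolding Nt by (rule rate1_cross_BF_eq_R_I2[OF positive distributed_signal_gain_BF])
  moreover have "rate1 Nt P11 P12 BF IC = R_BF P11 Nt"
    unfolding Nt by (rule rate1_cross_IC_eq_R_BF[OF \<open>P11 > 0\<close> distributed_signal_gain_BF])
  moreover have "rate1 Nt P11 P12 IC IC = R_BF P11 (Nt - 1)"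
    unfolding Nt diff_Suc_1
    by (rule rate1_cross_IC_eq_R_BF[OF \<open>P11 > 0\<close> distributed_signal_gain_IC])
  moreover have "rate1 Nt P11 P12 IC BF = R_I2 P11 P12 (Nt - 1)"
    unfolding Nt diff_Suc_1
    by (rule rate1_cross_BF_eq_R_I2[OF positive distributed_signal_gain_IC])
  ultimately show ?thesis
    by blast
qed

end
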